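(* Let $d\ge1$ and $q\ge1$ be integers, $D>0$ and $V_q\ge 0$. Let $f:[0,D^2]\to\mathbb{R}$ be such that $f$ and its derivatives through $f^{(q-1)}$ are absolutely continuous on $[0,D^2]$ and the $q$-th derivative $f^{(q)}$ has bounded total variation on $[0,D^2]$, with total variation $V(f^{(q)})\le V_q$. Define $\mathcal{K}(\mathbf{x},\mathbf{y})=f(\|\mathbf{x}-\mathbf{y}\|_2^2)$ for $\mathbf{x},\mathbf{y}\in[0,D/\sqrt d]^d$. Then for every integer $n>q$, with $$R=R(n,d)=\binom{n+d+2}{d+2},$$ there exist real $d$-variable polynomials $g_1,\dots,g_R$ and $h_1,\dots,h_R$ such that for all $\mathbf{x},\mathbf{y}\in[0,D/\sqrt d]^d$, $$\Big|\mathcal{K}(\mathbf{x},\mathbf{y})-\sum_{i=1}^{R}g_i(\mathbf{x})h_i(\mathbf{y})\Big|\le\frac{2V_qD^{2q}}{\pi q\,[2(n-q)]^q}.$$ *)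

theory Defs
  imports "HOL-Analysis.Analysis"
begin

definition absolutely_continuous_on :: "real set \<Rightarrow> (real \<Rightarrow> real) \<Rightarrow> bool" where
  "absolutely_continuous_on S f \<longleftrightarrow>
     (\<forall>\<epsilon>>0. \<exists>\<delta>>0. \<forall>(N::nat) a b.
        (\<forall>i<N. a i \<le> b i \<and> {a i..b i} \<subseteq> S) \<longrightarrow>
        pairwise (\<lambda>i j. disjnt {a i<..<b i} {a j<..<b j}) {..<N} \<longrightarrow>
        (\<Sum>i<N. b i - a i) < \<delta> \<longrightarrow>
        (\<Sum>i<N. \<bar>f (b i) - f (a i)\<bar>) < \<epsilon>)"

(* Extended-valued, so that a finite upper bound entails bounded variation. *)
definition total_variation_on :: "real set \<Rightarrow> (real \<Rightarrow> real) \<Rightarrow> ennreal" where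
  "total_variation_on S f =
     (SUP t \<in> {t. sorted t \<and> set t \<subseteq> S}.
        \<Sum>i<length t - 1. ennreal \<bar>f (t ! Suc i) - f (t ! i)\<bar>)"

(* F lists the derivatives of f up to order q on S, one-sided at the end points of an
   interval S.  The derivatives of order below q exist everywhere.  Since the one of order
   q - 1 is only absolutely continuous, the q-th derivative is determined only almost
   everywhere (e.g. f x = \<bar>x - c\<bar> with q = 1), so F q is any function agreeing with it
   almost everywhere. *)
definition derivatives_upto :: "nat \<Rightarrow> real set \<Rightarrow> (real \<Rightarrow> real) \<Rightarrow> (nat \<Rightarrow> real \<Rightarrow> real) \<Rightarrow> bool" where
  "derivatives_upto q S f F \<longleftrightarrow>
     (\<forall>x\<in>S. F 0 x = f x) \<and>
     (\<forall>k. Suc k < q \<longrightarrow>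
        (\<forall>x\<in>S. (F k has_real_derivative F (Suc k) x) (at x within S))) \<and>
     (\<forall>k. Suc k = q \<longrightarrow>
        (AE x\<in>S in lborel. (F k has_real_derivative F (Suc k) x) (at x within S)))"

end

theory Submission
  imports Defs
begin

text \<open>In the variable \<open>\<theta>\<close> with \<open>x = L / 2 * (1 - cos \<theta>)\<close>, \<open>L = D\<^sup>2\<close>, the Chebyshev expansion of \<open>f\<close>
  is a cosine series. Integration by parts expresses the \<open>k\<close>-th moment of \<open>F j\<close> through the moments
  \<open>k - 1\<close> and \<open>k + 1\<close> of \<open>F (j + 1)\<close>, and the moments of \<open>F q\<close> are at most \<open>V / k\<close>; hence the
  moments of \<open>f\<close> are at most \<open>V * (L / 2) ^ q / (k * (k - 1) * \<dots> * (k - q))\<close>, and the tail of the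
  series telescopes to the claimed bound. The truncated series is a polynomial of degree \<open>n\<close> in
  \<open>\<parallel>x - y\<parallel>\<^sup>2 = \<parallel>x\<parallel>\<^sup>2 + \<parallel>y\<parallel>\<^sup>2 - 2 * (\<Sum>i. x\<^sub>i * y\<^sub>i)\<close>, hence a combination of the monomials of degree at
  most \<open>n\<close> in these \<open>d + 2\<close> separated terms.\<close>

subsection \<open>Absolutely continuous functions\<close>

text \<open>Two obstacles shape the argument. The derivative of order \<open>q\<close> exists only
  almost everywhere, so the last integration by parts rests on a fundamental theorem with a null
  exceptional set, and null sets have to be pulled back along the substitution. About
  \<open>F q\<close> only a variation bound is known; pairing points at which the cosine takes
  opposite values yields \<open>V / k\<close> from sums of differences, with no Stieltjes integral.
  Decay of the moments gives convergence of the series but not its sum: the limit is identified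
  because a continuous function is determined by its cosine moments. The constant
  \<open>2 / pi\<close> is the cosine normalisation. Each integration by parts contributes
  \<open>L / 2\<close> and one more factor of the denominator; telescoping yields
  \<open>1 / q\<close> and leaves \<open>q\<close> factors, each at least \<open>n - q\<close>. The
  \<open>d + 2\<close> separated terms are the two squared norms and the \<open>d\<close> coordinate
  products, and the binomial coefficient counts the monomials of degree at most \<open>n\<close> in
  them.\<close>

lemma absolutely_continuous_onE:
  assumes "absolutely_continuous_on S f" "\<epsilon> > 0"
  obtains \<delta> where "\<delta> > 0" "\<And>(N::nat) a b. \<lbrakk>\<forall>i<N. a i \<le> b i \<and> {a i..b i} \<subseteq> S;
        pairwise (\<lambda>i j. disjnt {a i<..<b i} {a j<..<b j}) {..<N};
        (\<Sum>i<N. b i - a i) < \<delta>\<rbrakk> \<Longrightarrow> (\<Sum>i<N. \<bar>f (b i) - f (a i)\<bar>) < \<epsilon>"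
  using assms unfolding absolutely_continuous_on_def by blast

text \<open>A tagged division is a finite set of pairs rather than a sequence; a bijection with an
  initial segment of the naturals carries the definition over to such index sets.\<close>

lemma absolutely_continuous_onD:
  assumes "absolutely_continuous_on S f" "\<epsilon> > 0"
  obtains \<delta> where "\<delta> > 0"
    "\<And>(I :: 'i set) a b. \<lbrakk>finite I; \<And>i. i \<in> I \<Longrightarrow> a i \<le> b i \<and> {a i..b i} \<subseteq> S;
        pairwise (\<lambda>i j. disjnt {a i<..<b i} {a j<..<b j}) I; (\<Sum>i\<in>I. b i - a i) < \<delta>\<rbrakk>
      \<Longrightarrow> (\<Sum>i\<in>I. \<bar>f (b i) - f (a i)\<bar>) < \<epsilon>"
proof -
  obtain \<delta> where "\<delta> > 0" and
    \<delta>: "\<And>(N::nat) a b. \<lbrakk>\<forall>i<N. a i \<le> b i \<and> {a i..b i} \<subseteq> S;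
        pairwise (\<lambda>i j. disjnt {a i<..<b i} {a j<..<b j}) {..<N};
        (\<Sum>i<N. b i - a i) < \<delta>\<rbrakk> \<Longrightarrow> (\<Sum>i<N. \<bar>f (b i) - f (a i)\<bar>) < \<epsilon>"
    by (rule absolutely_continuous_onE[OF assms]) (rule that)
  show ?thesis
  proof (rule that[OF \<open>\<delta> > 0\<close>])
    fix I :: "'i set" and a b
    assume I: "finite I" "\<And>i. i \<in> I \<Longrightarrow> a i \<le> b i \<and> {a i..b i} \<subseteq> S"
      and pw: "pairwise (\<lambda>i j. disjnt {a i<..<b i} {a j<..<b j}) I"
      and less: "(\<Sum>i\<in>I. b i - a i) < \<delta>"
    obtain h where h: "bij_betw h {..<card I} I"
      using ex_bij_betw_nat_finite[OF \<open>finite I\<close>] by (auto simp: atLeast0LessThan)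
    have hI: "h i \<in> I" if "i < card I" for i
      using h that by (auto simp: bij_betw_def)
    have "(\<Sum>i<card I. \<bar>f (b (h i)) - f (a (h i))\<bar>) < \<epsilon>"
    proof (rule \<delta>)
      show "\<forall>i<card I. a (h i) \<le> b (h i) \<and> {a (h i)..b (h i)} \<subseteq> S"
        using I(2) hI by blast
      show "pairwise (\<lambda>i j. disjnt {a (h i)<..<b (h i)} {a (h j)<..<b (h j)}) {..<card I}"
        using pw hI h unfolding pairwise_def bij_betw_def inj_on_def by blast
      show "(\<Sum>i<card I. b (h i) - a (h i)) < \<delta>"
        using less by (simp add: sum.reindex_bij_betw[OF h, of "\<lambda>i. b i - a i"])
    qed
    then show "(\<Sum>i\<in>I. \<bar>f (b i) - f (a i)\<bar>) < \<epsilon>"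
      by (simp add: sum.reindex_bij_betw[OF h, of "\<lambda>i. \<bar>f (b i) - f (a i)\<bar>"])
  qed
qed

lemma absolutely_continuous_on_imp_continuous_on:
  assumes "absolutely_continuous_on {a..b} f"
  shows "continuous_on {a..b} f"
  unfolding continuous_on_iff
proof (intro ballI allI impI)
  fix x \<epsilon> :: real assume x: "x \<in> {a..b}" and "\<epsilon> > 0"
  obtain \<delta> where "\<delta> > 0" and
    \<delta>: "\<And>(N::nat) l r. \<lbrakk>\<forall>i<N. l i \<le> r i \<and> {l i..r i} \<subseteq> {a..b};
        pairwise (\<lambda>i j. disjnt {l i<..<r i} {l j<..<r j}) {..<N};
        (\<Sum>i<N. r i - l i) < \<delta>\<rbrakk> \<Longrightarrow> (\<Sum>i<N. \<bar>f (r i) - f (l i)\<bar>) < \<epsilon>"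
    by (rule absolutely_continuous_onE[OF assms \<open>\<epsilon> > 0\<close>]) (rule that)
  have "\<bar>f y - f x\<bar> < \<epsilon>" if y: "y \<in> {a..b}" "\<bar>y - x\<bar> < \<delta>" for y
    using \<delta>[of 1 "\<lambda>_. min x y" "\<lambda>_. max x y"] x y
    by (cases "x \<le> y") (auto simp: abs_minus_commute pairwise_def)
  then show "\<exists>\<delta>>0. \<forall>y\<in>{a..b}. dist y x < \<delta> \<longrightarrow> dist (f y) (f x) < \<epsilon>"
    using \<open>\<delta> > 0\<close> by (auto simp: dist_real_def)
qed

lemma absolutely_continuous_on_lipschitz:
  fixes f :: "real \<Rightarrow> real"
  assumes "\<And>x y. \<lbrakk>x \<in> S; y \<in> S; x \<le> y\<rbrakk> \<Longrightarrow> \<bar>f y - f x\<bar> \<le> C * (y - x)"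
  shows "absolutely_continuous_on S f"
  unfolding absolutely_continuous_on_def
proof (intro allI impI)
  fix \<epsilon> :: real assume "\<epsilon> > 0"
  \<comment> \<open>Positive whatever the sign of \<open>C\<close>, so that
    \<open>\<epsilon> / K\<close> can serve as the threshold.\<close>
  define K where "K = \<bar>C\<bar> + 1"
  have "K > 0" by (simp add: K_def)
  have "(\<Sum>i<N. \<bar>f (b i) - f (a i)\<bar>) < \<epsilon>"
    if ab: "\<forall>i<N. a i \<le> b i \<and> {a i..b i} \<subseteq> S" and less: "(\<Sum>i<N. b i - a i) < \<epsilon> / K" for N :: nat and a b
  proof -
    have "(\<Sum>i<N. \<bar>f (b i) - f (a i)\<bar>) \<le> (\<Sum>i<N. K * (b i - a i))"
    proof (rule sum_mono)
      fix i assume "i \<in> {..<N}"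
      then have "a i \<le> b i" "a i \<in> S" "b i \<in> S"
        using ab by (auto simp: subset_iff)
      then have "\<bar>f (b i) - f (a i)\<bar> \<le> C * (b i - a i)" by (intro assms)
      moreover have "C * (b i - a i) \<le> K * (b i - a i)"
        using \<open>a i \<le> b i\<close> by (intro mult_right_mono) (auto simp: K_def)
      ultimately show "\<bar>f (b i) - f (a i)\<bar> \<le> K * (b i - a i)" by linarith
    qed
    also have "\<dots> < \<epsilon>"
      using less \<open>K > 0\<close> unfolding sum_distrib_left[symmetric] by (simp add: pos_less_divide_eq mult.commute)
    finally show ?thesis .
  qed
  then show "\<exists>\<delta>>0. \<forall>(N::nat) a b. (\<forall>i<N. a i \<le> b i \<and> {a i..b i} \<subseteq> S) \<longrightarrow>
        pairwise (\<lambda>i j. disjnt {a i<..<b i} {a j<..<b j}) {..<N} \<longrightarrow>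
        (\<Sum>i<N. b i - a i) < \<delta> \<longrightarrow> (\<Sum>i<N. \<bar>f (b i) - f (a i)\<bar>) < \<epsilon>"
    using \<open>\<epsilon> > 0\<close> \<open>K > 0\<close> by (intro exI[of _ "\<epsilon> / K"]) auto
qed

text \<open>Integration by parts will be the fundamental theorem applied to a product. Both factors
  are bounded, being continuous on a compact interval, and the product rule for differences does the
  rest.\<close>

lemma absolutely_continuous_on_mult:
  fixes f g :: "real \<Rightarrow> real"
  assumes f: "absolutely_continuous_on {l..u} f" and g: "absolutely_continuous_on {l..u} g"
  shows "absolutely_continuous_on {l..u} (\<lambda>x. f x * g x)"
  unfolding absolutely_continuous_on_def
proof (intro allI impI)
  fix \<epsilon> :: real assume "\<epsilon> > 0"
  have bdd: "\<exists>B>0. \<forall>x\<in>{l..u}. \<bar>h x\<bar> \<le> B" if "absolutely_continuous_on {l..u} h" for h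
    using compact_imp_bounded[OF compact_continuous_image[OF absolutely_continuous_on_imp_continuous_on[OF that]]]
    by (auto simp: bounded_pos)
  obtain A B where A: "A > 0" "\<And>x. x \<in> {l..u} \<Longrightarrow> \<bar>f x\<bar> \<le> A"
    and B: "B > 0" "\<And>x. x \<in> {l..u} \<Longrightarrow> \<bar>g x\<bar> \<le> B"
    using bdd[OF f] bdd[OF g] by blast
  have pos: "\<epsilon> / (2 * A) > 0" "\<epsilon> / (2 * B) > 0" using A B \<open>\<epsilon> > 0\<close> by auto
  obtain \<delta>1 where \<delta>1: "\<delta>1 > 0" and
    f\<delta>: "\<And>(N::nat) a b. \<lbrakk>\<forall>i<N. a i \<le> b i \<and> {a i..b i} \<subseteq> {l..u};
        pairwise (\<lambda>i j. disjnt {a i<..<b i} {a j<..<b j}) {..<N};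
        (\<Sum>i<N. b i - a i) < \<delta>1\<rbrakk> \<Longrightarrow> (\<Sum>i<N. \<bar>f (b i) - f (a i)\<bar>) < \<epsilon> / (2 * B)"
    by (rule absolutely_continuous_onE[OF f pos(2)]) (rule that)
  obtain \<delta>2 where \<delta>2: "\<delta>2 > 0" and
    g\<delta>: "\<And>(N::nat) a b. \<lbrakk>\<forall>i<N. a i \<le> b i \<and> {a i..b i} \<subseteq> {l..u};
        pairwise (\<lambda>i j. disjnt {a i<..<b i} {a j<..<b j}) {..<N};
        (\<Sum>i<N. b i - a i) < \<delta>2\<rbrakk> \<Longrightarrow> (\<Sum>i<N. \<bar>g (b i) - g (a i)\<bar>) < \<epsilon> / (2 * A)"
    by (rule absolutely_continuous_onE[OF g pos(1)]) (rule that)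
  have "(\<Sum>i<N. \<bar>f (b i) * g (b i) - f (a i) * g (a i)\<bar>) < \<epsilon>"
    if ab: "\<forall>i<N. a i \<le> b i \<and> {a i..b i} \<subseteq> {l..u}"
      and pw: "pairwise (\<lambda>i j. disjnt {a i<..<b i} {a j<..<b j}) {..<N}"
      and less: "(\<Sum>i<N. b i - a i) < min \<delta>1 \<delta>2" for N :: nat and a b
  proof -
    have "(\<Sum>i<N. \<bar>f (b i) * g (b i) - f (a i) * g (a i)\<bar>)
        \<le> (\<Sum>i<N. B * \<bar>f (b i) - f (a i)\<bar> + A * \<bar>g (b i) - g (a i)\<bar>)"
    proof (rule sum_mono)
      fix i assume "i \<in> {..<N}"
      then have i: "a i \<in> {l..u}" "b i \<in> {l..u}" using ab by auto
      have "f (b i) * g (b i) - f (a i) * g (a i)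
          = g (b i) * (f (b i) - f (a i)) + f (a i) * (g (b i) - g (a i))"
        by (simp add: algebra_simps)
      then have "\<bar>f (b i) * g (b i) - f (a i) * g (a i)\<bar>
          \<le> \<bar>g (b i)\<bar> * \<bar>f (b i) - f (a i)\<bar> + \<bar>f (a i)\<bar> * \<bar>g (b i) - g (a i)\<bar>"
        by (metis abs_mult abs_triangle_ineq)
      also have "\<dots> \<le> B * \<bar>f (b i) - f (a i)\<bar> + A * \<bar>g (b i) - g (a i)\<bar>"
        using A B i by (intro add_mono mult_right_mono) auto
      finally show "\<bar>f (b i) * g (b i) - f (a i) * g (a i)\<bar>
          \<le> B * \<bar>f (b i) - f (a i)\<bar> + A * \<bar>g (b i) - g (a i)\<bar>" .
    qed
    also have "\<dots> = B * (\<Sum>i<N. \<bar>f (b i) - f (a i)\<bar>) + A * (\<Sum>i<N. \<bar>g (b i) - g (a i)\<bar>)"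
      by (simp add: sum.distrib sum_distrib_left)
    also have "\<dots> < B * (\<epsilon> / (2 * B)) + A * (\<epsilon> / (2 * A))"
      using f\<delta>[OF ab pw] g\<delta>[OF ab pw] less A B by (intro add_strict_mono mult_strict_left_mono) auto
    also have "\<dots> = \<epsilon>" using A B by simp
    finally show ?thesis .
  qed
  then show "\<exists>\<delta>>0. \<forall>(N::nat) a b. (\<forall>i<N. a i \<le> b i \<and> {a i..b i} \<subseteq> {l..u}) \<longrightarrow>
        pairwise (\<lambda>i j. disjnt {a i<..<b i} {a j<..<b j}) {..<N} \<longrightarrow>
        (\<Sum>i<N. b i - a i) < \<delta> \<longrightarrow> (\<Sum>i<N. \<bar>f (b i) * g (b i) - f (a i) * g (a i)\<bar>) < \<epsilon>"
    using \<delta>1 \<delta>2 by (intro exI[of _ "min \<delta>1 \<delta>2"]) auto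
qed

text \<open>Compositions of absolutely continuous functions can fail to be absolutely continuous.
  Here monotonicity of \<open>h\<close> carries nonoverlapping intervals to nonoverlapping ones, and
  the Lipschitz bound controls their total length.\<close>

lemma absolutely_continuous_on_compose:
  fixes f h :: "real \<Rightarrow> real"
  assumes f: "absolutely_continuous_on {l..u} f" and "strict_mono_on {a..b} h"
    and "h ` {a..b} \<subseteq> {l..u}"
    and "K > 0" and lip: "\<And>x y. \<lbrakk>x \<in> {a..b}; y \<in> {a..b}; x \<le> y\<rbrakk> \<Longrightarrow> h y - h x \<le> K * (y - x)"
  shows "absolutely_continuous_on {a..b} (\<lambda>x. f (h x))"
  unfolding absolutely_continuous_on_def
proof (intro allI impI)
  fix \<epsilon> :: real assume "\<epsilon> > 0"
  obtain \<delta> where \<delta>: "\<delta> > 0" and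
    f\<delta>: "\<And>(N::nat) a b. \<lbrakk>\<forall>i<N. a i \<le> b i \<and> {a i..b i} \<subseteq> {l..u};
        pairwise (\<lambda>i j. disjnt {a i<..<b i} {a j<..<b j}) {..<N};
        (\<Sum>i<N. b i - a i) < \<delta>\<rbrakk> \<Longrightarrow> (\<Sum>i<N. \<bar>f (b i) - f (a i)\<bar>) < \<epsilon>"
    by (rule absolutely_continuous_onE[OF f \<open>\<epsilon> > 0\<close>]) (rule that)
  have mono: "h x \<le> h y \<longleftrightarrow> x \<le> y" if "x \<in> {a..b}" "y \<in> {a..b}" for x y
    using \<open>strict_mono_on {a..b} h\<close> that by (meson strict_mono_on_leD leD not_le strict_mono_onD)
  have "(\<Sum>i<N. \<bar>f (h (r i)) - f (h (l' i))\<bar>) < \<epsilon>"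
    if lr: "\<forall>i<N. l' i \<le> r i \<and> {l' i..r i} \<subseteq> {a..b}"
      and pw: "pairwise (\<lambda>i j. disjnt {l' i<..<r i} {l' j<..<r j}) {..<N}"
      and less: "(\<Sum>i<N. r i - l' i) < \<delta> / K" for N :: nat and l' r
  proof (rule f\<delta>)
    have in_ab: "l' i \<in> {a..b}" "r i \<in> {a..b}" "l' i \<le> r i" if "i < N" for i using lr that by auto
    show "\<forall>i<N. h (l' i) \<le> h (r i) \<and> {h (l' i)..h (r i)} \<subseteq> {l..u}"
      using in_ab mono \<open>h ` {a..b} \<subseteq> {l..u}\<close> by (fastforce simp: subset_iff)
    show "pairwise (\<lambda>i j. disjnt {h (l' i)<..<h (r i)} {h (l' j)<..<h (r j)}) {..<N}"
    proof (rule pairwiseI)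
      fix i j assume ij: "i \<in> {..<N}" "j \<in> {..<N}" "i \<noteq> j"
      have "disjnt {l' i<..<r i} {l' j<..<r j}" using pw ij by (auto simp: pairwise_def)
      then have "\<not> max (l' i) (l' j) < min (r i) (r j)"
        using dense[of "max (l' i) (l' j)" "min (r i) (r j)"] by (auto simp: disjnt_iff)
      \<comment> \<open>The first two alternatives are degenerate intervals, whose interior is empty
        wherever they lie.\<close>
      then have "l' i = r i \<or> l' j = r j \<or> r i \<le> l' j \<or> r j \<le> l' i"
        using in_ab[of i] in_ab[of j] ij by (auto simp: max_def min_def split: if_splits)
      then have "h (l' i) = h (r i) \<or> h (l' j) = h (r j) \<or> h (r i) \<le> h (l' j) \<or> h (r j) \<le> h (l' i)"
        using in_ab[of i] in_ab[of j] ij mono by auto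
      then show "disjnt {h (l' i)<..<h (r i)} {h (l' j)<..<h (r j)}"
        by (auto simp: disjnt_def)
    qed
    have "(\<Sum>i<N. h (r i) - h (l' i)) \<le> (\<Sum>i<N. K * (r i - l' i))"
      by (intro sum_mono lip in_ab) auto
    also have "\<dots> < \<delta>" using less \<open>K > 0\<close> unfolding sum_distrib_left[symmetric] by (simp add: pos_less_divide_eq mult.commute)
    finally show "(\<Sum>i<N. h (r i) - h (l' i)) < \<delta>" .
  qed
  then show "\<exists>\<delta>>0. \<forall>(N::nat) l' r. (\<forall>i<N. l' i \<le> r i \<and> {l' i..r i} \<subseteq> {a..b}) \<longrightarrow>
        pairwise (\<lambda>i j. disjnt {l' i<..<r i} {l' j<..<r j}) {..<N} \<longrightarrow>
        (\<Sum>i<N. r i - l' i) < \<delta> \<longrightarrow> (\<Sum>i<N. \<bar>f (h (r i)) - f (h (l' i))\<bar>) < \<epsilon>"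
    using \<delta> \<open>K > 0\<close> by (intro exI[of _ "\<delta> / K"]) auto
qed

text \<open>Tags in the exceptional null set are handled by absolute continuity, since the gauge can
  force their intervals into an open set of small measure.\<close>
lemma fundamental_theorem_of_calculus_absolutely_continuous:
  fixes f f' :: "real \<Rightarrow> real"
  assumes "a \<le> b" and ac: "absolutely_continuous_on {a..b} f" and "negligible N"
    and der: "\<And>x. x \<in> {a..b} - N \<Longrightarrow> (f has_real_derivative f' x) (at x within {a..b})"
  shows "(f' has_integral (f b - f a)) {a..b}"
proof (cases "a = b")
  case True
  then show ?thesis by (simp add: has_integral_refl)
next
  case False
  with \<open>a \<le> b\<close> have "a < b" by simp
  \<comment> \<open>With the value 0 on \<open>N\<close>, a Riemann-sum term tagged in
    \<open>N\<close> vanishes and only the increment of \<open>f\<close> remains to be estimated;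
    the values of \<open>f'\<close> on the negligible set are restored at the end.\<close>
  define g where "g x = (if x \<in> N then 0 else f' x)" for x
  have "(g has_integral (f b - f a)) {a..b}"
    unfolding has_integral_factor_content box_real[symmetric]
  proof (intro allI impI)
    fix e :: real assume "e > 0"
    define \<epsilon> where "\<epsilon> = e / 2"
    have "\<epsilon> > 0" using \<open>e > 0\<close> by (simp add: \<epsilon>_def)
    have "\<forall>x. \<exists>d>0. x \<in> {a..b} - N \<longrightarrow>
         (\<forall>y\<in>{a..b}. norm (y-x) < d \<longrightarrow> norm (f y - f x - (y-x) *\<^sub>R f' x) \<le> \<epsilon> * norm (y-x))"
      using der[unfolded has_real_derivative_iff_has_vector_derivative has_vector_derivative_def
          has_derivative_within_alt] \<open>\<epsilon> > 0\<close> by (metis zero_less_one)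
    then obtain d where d: "\<And>x. 0 < d x"
      "\<And>x y. \<lbrakk>x \<in> {a..b} - N; y \<in> {a..b}; norm (y-x) < d x\<rbrakk>
          \<Longrightarrow> norm (f y - f x - (y-x) *\<^sub>R f' x) \<le> \<epsilon> * norm (y-x)"
      by metis
    have "\<epsilon> * (b - a) > 0" using \<open>\<epsilon> > 0\<close> \<open>a < b\<close> by simp
    obtain \<delta> where "\<delta> > 0" and \<delta>:
      "\<And>(I :: (real \<times> real set) set) l r. \<lbrakk>finite I; \<And>i. i \<in> I \<Longrightarrow> l i \<le> r i \<and> {l i..r i} \<subseteq> {a..b};
        pairwise (\<lambda>i j. disjnt {l i<..<r i} {l j<..<r j}) I; (\<Sum>i\<in>I. r i - l i) < \<delta>\<rbrakk>
      \<Longrightarrow> (\<Sum>i\<in>I. \<bar>f (r i) - f (l i)\<bar>) < \<epsilon> * (b - a)"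
      by (rule absolutely_continuous_onD[OF ac \<open>\<epsilon> * (b - a) > 0\<close>]) blast
    have N0: "N \<in> null_sets lebesgue" using \<open>negligible N\<close> by (simp add: negligible_iff_null_sets)
    \<comment> \<open>Outer regularity; as \<open>N\<close> is null, \<open>U\<close> itself has
      measure below \<open>\<delta>\<close>.\<close>
    then obtain U where U: "open U" "N \<subseteq> U" "emeasure lebesgue (U - N) < ennreal \<delta>"
      using sets_lebesgue_outer_open[of N \<delta>] \<open>\<delta> > 0\<close> by (metis null_setsD2)
    have "emeasure lebesgue U = emeasure lebesgue (U - N)"
      using N0 U(1) by (intro emeasure_Diff_null_set[symmetric]) auto
    then have U_small: "emeasure lborel U < ennreal \<delta>"
      using U by simp
    define \<gamma> where "\<gamma> x = (if x \<in> N then U else ball x (d x))" for x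
    show "\<exists>\<gamma>. gauge \<gamma> \<and> (\<forall>p. p tagged_division_of (cbox a b) \<and> \<gamma> fine p \<longrightarrow>
      norm ((\<Sum>(x, k)\<in>p. measure lborel k *\<^sub>R g x) - (f b - f a)) \<le> e * measure lborel (cbox a b))"
    proof (rule exI[of _ \<gamma>], safe)
      show "gauge \<gamma>" using d U by (auto simp: gauge_def \<gamma>_def)
    next
      fix p assume ptag: "p tagged_division_of cbox a b" and fine: "\<gamma> fine p"
      have "finite p" using ptag by blast
      have p_int: "\<exists>u v. K = {u..v} \<and> u \<le> x \<and> x \<le> v \<and> a \<le> u \<and> v \<le> b" if "(x, K) \<in> p" for x K
        using tagged_division_ofD(2-4)[OF ptag that] by (fastforce simp: subset_iff)
      define p1 where "p1 = {i \<in> p. fst i \<in> N}"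
      define D where "D = (\<lambda>(x::real, K). measure lborel K *\<^sub>R g x - (f (Sup K) - f (Inf K)))"
      have "(\<Sum>(x, k)\<in>p. measure lborel k *\<^sub>R g x) - (f b - f a) = (\<Sum>i\<in>p. D i)"
        using additive_tagged_division_1[of a b p f] \<open>a \<le> b\<close> ptag
        by (simp add: D_def split_def sum_subtractf)
      also have "\<dots> = (\<Sum>i\<in>p1. D i) + (\<Sum>i\<in>p - p1. D i)"
        using \<open>finite p\<close> by (subst sum.subset_diff[of p1 p]) (auto simp: p1_def)
      finally have split: "(\<Sum>(x, k)\<in>p. measure lborel k *\<^sub>R g x) - (f b - f a) = (\<Sum>i\<in>p1. D i) + (\<Sum>i\<in>p - p1. D i)" .
      have "norm (\<Sum>i\<in>p - p1. D i) \<le> (\<Sum>i\<in>p - p1. \<epsilon> * (Sup (snd i) - Inf (snd i)))"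
      proof (rule sum_norm_le)
        fix i assume i: "i \<in> p - p1"
        obtain x K where [simp]: "i = (x, K)" by fastforce
        have xK: "(x, K) \<in> p" "x \<notin> N" using i by (auto simp: p1_def)
        obtain u v where uv: "K = {u..v}" "u \<le> x" "x \<le> v" "a \<le> u" "v \<le> b"
          using p_int[OF xK(1)] by blast
        have "K \<subseteq> \<gamma> x" using fine xK(1) by (auto simp: fine_def)
        then have "K \<subseteq> ball x (d x)" using xK(2) by (simp add: \<gamma>_def)
        moreover have "u \<in> K" "v \<in> K" using uv by auto
        ultimately have "u \<in> ball x (d x)" "v \<in> ball x (d x)" by blast+
        then have "norm (u - x) < d x" "norm (v - x) < d x"
          by (auto simp: dist_real_def abs_minus_commute)
        then have b: "norm (f u - f x - (u - x) *\<^sub>R f' x) \<le> \<epsilon> * norm (u - x)"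
            "norm (f v - f x - (v - x) *\<^sub>R f' x) \<le> \<epsilon> * norm (v - x)"
          using d(2)[of x u] d(2)[of x v] uv xK by auto
        \<comment> \<open>Splitting the increment at the tag keeps the error proportional to the
          length, since \<open>u \<le> x \<le> v\<close> gives
          \<open>\<bar>u - x\<bar> + \<bar>v - x\<bar> = v - u\<close>.\<close>
        have "D i = (f u - f x - (u - x) *\<^sub>R f' x) - (f v - f x - (v - x) *\<^sub>R f' x)"
          using uv xK by (simp add: D_def g_def algebra_simps)
        then have "norm (D i) \<le> \<epsilon> * norm (u - x) + \<epsilon> * norm (v - x)"
          using b norm_triangle_ineq4 by (smt (verit))
        also have "\<dots> = \<epsilon> * (Sup (snd i) - Inf (snd i))"
          using uv by (simp add: algebra_simps)
        finally show "norm (D i) \<le> \<epsilon> * (Sup (snd i) - Inf (snd i))" .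
      qed
      also have "\<dots> \<le> (\<Sum>i\<in>p. \<epsilon> * (Sup (snd i) - Inf (snd i)))"
        using \<open>finite p\<close> \<open>\<epsilon> > 0\<close> p_int
        by (intro sum_mono2) (force intro!: mult_nonneg_nonneg)+
      also have "\<dots> = \<epsilon> * (b - a)"
        using additive_tagged_division_1[of a b p "\<lambda>x. x"] \<open>a \<le> b\<close> ptag
        by (simp add: sum_distrib_left[symmetric] split_def)
      finally have 1: "norm (\<Sum>i\<in>p - p1. D i) \<le> \<epsilon> * (b - a)" .
      have p1: "\<exists>x u v. i = (x, {u..v}) \<and> u \<le> v \<and> a \<le> u \<and> v \<le> b \<and> {u..v} \<subseteq> U \<and> x \<in> N" if "i \<in> p1" for i
      proof -
        obtain x K where i: "i = (x, K)" by fastforce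
        have "(x, K) \<in> p" "x \<in> N" using that i by (auto simp: p1_def)
        moreover have "K \<subseteq> \<gamma> x" using fine calculation by (auto simp: fine_def)
        then have "K \<subseteq> U" using \<open>x \<in> N\<close> by (simp add: \<gamma>_def)
        ultimately show ?thesis using p_int[of x K] i by fastforce
      qed
      have disj: "pairwise (\<lambda>i j. disjnt {Inf (snd i)<..<Sup (snd i)} {Inf (snd j)<..<Sup (snd j)}) p1"
      proof (rule pairwiseI)
        fix i j assume ij: "i \<in> p1" "j \<in> p1" "i \<noteq> j"
        obtain x u v where i: "i = (x, {u..v})" "u \<le> v" using p1[OF ij(1)] by blast
        obtain y s t where j: "j = (y, {s..t})" "s \<le> t" using p1[OF ij(2)] by blast
        have "interior {u..v} \<inter> interior {s..t} = {}"
          using ij i j by (intro tagged_division_ofD(5)[OF ptag]) (auto simp: p1_def)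
        then show "disjnt {Inf (snd i)<..<Sup (snd i)} {Inf (snd j)<..<Sup (snd j)}"
          using i j by (simp add: disjnt_def)
      qed
      have "finite p1" using \<open>finite p\<close> by (simp add: p1_def)
      \<comment> \<open>Neighbouring closed intervals may share end points, so the lengths are added
        over the open interiors, which are disjoint and lie in \<open>U\<close>.\<close>
      have "ennreal (\<Sum>i\<in>p1. Sup (snd i) - Inf (snd i)) = (\<Sum>i\<in>p1. emeasure lborel {Inf (snd i)<..<Sup (snd i)})"
        using p1 by (subst sum_ennreal[symmetric]) (force intro!: sum.cong)+
      also have "\<dots> = emeasure lborel (\<Union>i\<in>p1. {Inf (snd i)<..<Sup (snd i)})"
        using disj \<open>finite p1\<close>
        by (intro sum_emeasure) (auto simp: disjoint_family_on_def pairwise_def disjnt_def)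
      also have "\<dots> \<le> emeasure lborel U"
        using p1 U(1) by (intro emeasure_mono) (fastforce simp: subset_iff)+
      also have "\<dots> < ennreal \<delta>" by (rule U_small)
      finally have small: "(\<Sum>i\<in>p1. Sup (snd i) - Inf (snd i)) < \<delta>"
        by (metis ennreal_leI not_le)
      have "norm (\<Sum>i\<in>p1. D i) \<le> (\<Sum>i\<in>p1. \<bar>f (Sup (snd i)) - f (Inf (snd i))\<bar>)"
        using p1 by (intro sum_norm_le) (force simp: D_def g_def)
      also have "\<dots> < \<epsilon> * (b - a)"
        using p1 by (intro \<delta> \<open>finite p1\<close> disj small) force
      finally have 2: "norm (\<Sum>i\<in>p1. D i) \<le> \<epsilon> * (b - a)" by simp
      have "norm ((\<Sum>(x, k)\<in>p. measure lborel k *\<^sub>R g x) - (f b - f a)) \<le> \<epsilon> * (b - a) + \<epsilon> * (b - a)"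
        unfolding split using norm_triangle_le[OF add_mono[OF 2 1]] by simp
      also have "\<dots> = e * measure lborel (cbox a b)" using \<open>a \<le> b\<close> by (simp add: \<epsilon>_def algebra_simps)
      finally show "norm ((\<Sum>(x, k)\<in>p. measure lborel k *\<^sub>R g x) - (f b - f a)) \<le> e * measure lborel (cbox a b)" .
    qed
  qed
  then show ?thesis
    by (rule has_integral_spike[OF \<open>negligible N\<close>, rotated]) (auto simp: g_def)
qed

subsection \<open>Cosine moments\<close>

text \<open>Left unnormalised because the recursion at \<open>k = 1\<close> involves the moment of
  index 0, whose Fourier normalisation differs from the others.\<close>

definition cos_moment :: "(real \<Rightarrow> real) \<Rightarrow> nat \<Rightarrow> real" where
  "cos_moment g k = integral {0..pi} (\<lambda>\<theta>. g \<theta> * cos (real k * \<theta>))"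

text \<open>The sign is chosen so that the map increases from 0 to \<open>L\<close> on
  \<open>{0..pi}\<close>; partitions keep their order, and the usual Chebyshev variable is
  \<open>1 - 2 * x / L = cos \<theta>\<close>.\<close>

definition cheb_point :: "real \<Rightarrow> real \<Rightarrow> real" where
  "cheb_point L \<theta> = L / 2 * (1 - cos \<theta>)"

lemma cheb_point_has_derivative [derivative_intros]:
  "(cheb_point L has_real_derivative L / 2 * sin \<theta>) (at \<theta> within S)"
  unfolding cheb_point_def by (auto intro!: derivative_eq_intros)

lemma strict_mono_on_cheb_point: "L > 0 \<Longrightarrow> strict_mono_on {0..pi} (cheb_point L)"
  by (auto simp: strict_mono_on_def cheb_point_def cos_monotone_0_pi)

lemma cheb_point_mono: "\<lbrakk>L > 0; 0 \<le> x; x \<le> y; y \<le> pi\<rbrakk> \<Longrightarrow> cheb_point L x \<le> cheb_point L y"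
  by (auto simp: cheb_point_def cos_monotone_0_pi_le)

lemma cheb_point_in: "L > 0 \<Longrightarrow> cheb_point L \<theta> \<in> {0..L}"
proof -
  assume "L > 0"
  have "1 - cos \<theta> \<le> 2" "0 \<le> 1 - cos \<theta>" using cos_ge_minus_one[of \<theta>] by auto
  then have "L * (1 - cos \<theta>) \<le> L * 2" "0 \<le> L * (1 - cos \<theta>)"
    using \<open>L > 0\<close> by (auto intro: mult_left_mono mult_nonneg_nonneg simp del: mult_le_cancel_left_pos)
  then show ?thesis by (simp add: cheb_point_def)
qed

lemma cheb_point_lipschitz:
  assumes "L > 0" "x \<le> y"
  shows "cheb_point L y - cheb_point L x \<le> L * (y - x)"
proof (cases "x = y")
  case False
  with assms have "x < y" by simp
  obtain z where z: "cheb_point L y - cheb_point L x = (y - x) * (L / 2 * sin z)"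
    using MVT2[OF \<open>x < y\<close>, of "cheb_point L" "\<lambda>\<theta>. L / 2 * sin \<theta>"] cheb_point_has_derivative by blast
  have "L * sin z \<le> L * 1"
    using assms by (intro mult_left_mono) auto
  then have "L / 2 * sin z \<le> L" using assms(1) by linarith
  then have "(y - x) * (L / 2 * sin z) \<le> (y - x) * L" using assms by (intro mult_left_mono) auto
  then show ?thesis using z by (simp add: mult.commute)
qed auto

lemma absolutely_continuous_on_cheb_point:
  assumes "L > 0" and ac: "absolutely_continuous_on {0..L} f"
  shows "absolutely_continuous_on {0..pi} (\<lambda>\<theta>. f (cheb_point L \<theta>))"
  using ac strict_mono_on_cheb_point[OF \<open>L > 0\<close>] _ \<open>L > 0\<close>
proof (rule absolutely_continuous_on_compose)
  show "cheb_point L ` {0..pi} \<subseteq> {0..L}" using cheb_point_in[OF \<open>L > 0\<close>] by blast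
qed (use \<open>L > 0\<close> cheb_point_lipschitz in auto)

text \<open>The chain rule needs the preimage of a null set to be null. This holds in the open
  interval, where the derivative \<open>L / 2 * sin \<theta>\<close> does not vanish; the two end
  points join the exceptional set.\<close>

lemma AE_derivative_cheb_point:
  assumes "L > 0"
    and der: "AE x\<in>{0..L} in lborel. (f has_real_derivative f' x) (at x within {0..L})"
  obtains N where "negligible N"
    "\<And>\<theta>. \<theta> \<in> {0..pi} - N \<Longrightarrow>
      ((\<lambda>\<theta>. f (cheb_point L \<theta>)) has_real_derivative f' (cheb_point L \<theta>) * (L / 2 * sin \<theta>)) (at \<theta> within {0..pi})"
proof -
  obtain M where M: "M \<in> null_sets lborel"
    "\<And>x. \<lbrakk>x \<notin> M; x \<in> {0..L}\<rbrakk> \<Longrightarrow> (f has_real_derivative f' x) (at x within {0..L})"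
    using der unfolding eventually_ae_filter by auto
  have "negligible M" using M by (simp add: negligible_iff_null_sets null_sets_completionI)
  have "negligible {\<theta> \<in> {0<..<pi}. cheb_point L \<theta> \<in> M}"
  proof (rule negligible_differentiable_vimage[OF \<open>negligible M\<close>, of _ "\<lambda>\<theta> h. (L / 2 * sin \<theta>) * h"])
    fix \<theta> assume "\<theta> \<in> {0<..<pi}"
    then have "sin \<theta> > 0" by (simp add: sin_gt_zero)
    then show "inj (\<lambda>h. (L / 2 * sin \<theta>) * h)" using \<open>L > 0\<close> by (auto simp: inj_on_def)
    show "(cheb_point L has_derivative (*) (L / 2 * sin \<theta>)) (at \<theta> within {0<..<pi})"
      using cheb_point_has_derivative by (simp add: has_field_derivative_def)
  qed
  moreover have "negligible {0, pi}" by simp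
  ultimately have "negligible ({\<theta> \<in> {0<..<pi}. cheb_point L \<theta> \<in> M} \<union> {0, pi})"
    by (rule negligible_Un)
  then show ?thesis
  proof (rule that)
    fix \<theta> assume "\<theta> \<in> {0..pi} - ({\<theta> \<in> {0<..<pi}. cheb_point L \<theta> \<in> M} \<union> {0, pi})"
    then have "cheb_point L \<theta> \<notin> M" by auto
    then have d: "(f has_real_derivative f' (cheb_point L \<theta>)) (at (cheb_point L \<theta>) within {0..L})"
      using M(2) cheb_point_in[OF \<open>L > 0\<close>] by blast
    then have "(f has_real_derivative f' (cheb_point L \<theta>)) (at (cheb_point L \<theta>) within cheb_point L ` {0..pi})"
      using cheb_point_in[OF \<open>L > 0\<close>] by (auto intro: has_field_derivative_subset)
    from DERIV_image_chain[OF this cheb_point_has_derivative]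
    show "((\<lambda>\<theta>. f (cheb_point L \<theta>)) has_real_derivative f' (cheb_point L \<theta>) * (L / 2 * sin \<theta>)) (at \<theta> within {0..pi})"
      by (simp add: o_def)
  qed
qed

text \<open>As \<open>f'\<close> is bounded, only measurability is at stake. The product with
  \<open>L / 2 * sin \<theta>\<close> is integrable, being almost everywhere the derivative of an
  absolutely continuous function; dividing by this factor, positive in the open interval, leaves a
  measurable function.\<close>

lemma integrable_cheb_point:
  assumes "L > 0" and ac: "absolutely_continuous_on {0..L} f"
    and der: "AE x\<in>{0..L} in lborel. (f has_real_derivative f' x) (at x within {0..L})"
    and bdd: "\<And>x. x \<in> {0..L} \<Longrightarrow> \<bar>f' x\<bar> \<le> B"
    and c: "continuous_on UNIV c"
  shows "(\<lambda>\<theta>. f' (cheb_point L \<theta>) * c \<theta>) integrable_on {0..pi}"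
proof -
  obtain N where N: "negligible N"
    "\<And>\<theta>. \<theta> \<in> {0..pi} - N \<Longrightarrow>
      ((\<lambda>\<theta>. f (cheb_point L \<theta>)) has_real_derivative f' (cheb_point L \<theta>) * (L / 2 * sin \<theta>)) (at \<theta> within {0..pi})"
    by (rule AE_derivative_cheb_point[OF \<open>L > 0\<close> der]) blast
  have "(\<lambda>\<theta>. f' (cheb_point L \<theta>) * (L / 2 * sin \<theta>)) integrable_on {0..pi}"
    by (rule has_integral_integrable, rule fundamental_theorem_of_calculus_absolutely_continuous[OF pi_ge_zero
      absolutely_continuous_on_cheb_point[OF \<open>L > 0\<close> ac] N])
  then have "(\<lambda>\<theta>. f' (cheb_point L \<theta>) * (L / 2 * sin \<theta>)) integrable_on {0<..<pi}"
    by (simp add: integrable_on_Icc_iff_Ioo)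
  then have [measurable]: "(\<lambda>\<theta>. f' (cheb_point L \<theta>) * (L / 2 * sin \<theta>)) \<in> borel_measurable (lebesgue_on {0<..<pi})"
    by (rule integrable_imp_measurable)
  have [measurable]: "h \<in> borel_measurable (lebesgue_on {0<..<pi})" if "continuous_on UNIV h" for h :: "real \<Rightarrow> real"
    using that by (intro continuous_imp_measurable_on_sets_lebesgue) (auto intro: continuous_on_subset)
  have [measurable]: "c \<in> borel_measurable (lebesgue_on {0<..<pi})"
     "(\<lambda>\<theta>. L / 2 * sin \<theta>) \<in> borel_measurable (lebesgue_on {0<..<pi})"
    using c by (auto intro!: \<open>\<And>h. continuous_on UNIV h \<Longrightarrow> h \<in> _\<close> continuous_intros)
  have "(\<lambda>\<theta>. f' (cheb_point L \<theta>) * (L / 2 * sin \<theta>) / (L / 2 * sin \<theta>) * c \<theta>)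
      \<in> borel_measurable (lebesgue_on {0<..<pi})"
    by measurable
  also have "?this \<longleftrightarrow> (\<lambda>\<theta>. f' (cheb_point L \<theta>) * c \<theta>) \<in> borel_measurable (lebesgue_on {0<..<pi})"
    using \<open>L > 0\<close> by (intro measurable_cong) (auto dest: sin_gt_zero)
  finally have meas: "(\<lambda>\<theta>. f' (cheb_point L \<theta>) * c \<theta>) \<in> borel_measurable (lebesgue_on {0<..<pi})" .
  have "(\<lambda>\<theta>. f' (cheb_point L \<theta>) * c \<theta>) integrable_on {0<..<pi}"
  proof (rule measurable_bounded_by_integrable_imp_integrable[OF meas])
    have "(\<lambda>\<theta>. B * \<bar>c \<theta>\<bar>) integrable_on {0..pi}"
      by (intro integrable_continuous_interval continuous_intros continuous_on_subset[OF c]) auto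
    then show "(\<lambda>\<theta>. B * \<bar>c \<theta>\<bar>) integrable_on {0<..<pi}"
      by (simp add: integrable_on_Icc_iff_Ioo)
    show "norm (f' (cheb_point L \<theta>) * c \<theta>) \<le> B * \<bar>c \<theta>\<bar>" for \<theta>
      using bdd[OF cheb_point_in[OF \<open>L > 0\<close>]] by (auto simp: abs_mult intro: mult_right_mono)
  qed auto
  then show ?thesis by (simp add: integrable_on_Icc_iff_Ioo)
qed

text \<open>Differentiate the product of \<open>f (cheb_point L \<theta>)\<close> and
  \<open>sin (k * \<theta>)\<close>, which vanishes at 0 and \<open>pi\<close>, so that no boundary
  term appears. The chain rule brings in \<open>L / 2 * sin \<theta>\<close>, and
  \<open>sin \<theta> * sin (k * \<theta>)\<close> is half the difference of the cosines of index
  \<open>k - 1\<close> and \<open>k + 1\<close>; hence the factor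
  \<open>L / (4 * k)\<close>.\<close>

lemma cos_moment_by_parts:
  assumes "L > 0" and ac: "absolutely_continuous_on {0..L} f"
    and der: "AE x\<in>{0..L} in lborel. (f has_real_derivative f' x) (at x within {0..L})"
    and bdd: "\<And>x. x \<in> {0..L} \<Longrightarrow> \<bar>f' x\<bar> \<le> B"
    and "k \<ge> 1"
  shows "cos_moment (\<lambda>\<theta>. f (cheb_point L \<theta>)) k =
    L / (4 * real k) * (cos_moment (\<lambda>\<theta>. f' (cheb_point L \<theta>)) (k + 1) - cos_moment (\<lambda>\<theta>. f' (cheb_point L \<theta>)) (k - 1))"
proof -
  let ?G = "\<lambda>\<theta>. f (cheb_point L \<theta>)" and ?G' = "\<lambda>\<theta>. f' (cheb_point L \<theta>)" 
  let ?s = "\<lambda>\<theta>. sin (real k * \<theta>)"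
  obtain N where N: "negligible N"
    "\<And>\<theta>. \<theta> \<in> {0..pi} - N \<Longrightarrow> (?G has_real_derivative ?G' \<theta> * (L / 2 * sin \<theta>)) (at \<theta> within {0..pi})"
    by (rule AE_derivative_cheb_point[OF \<open>L > 0\<close> der]) blast
  have acG: "absolutely_continuous_on {0..pi} ?G"
    by (rule absolutely_continuous_on_cheb_point[OF \<open>L > 0\<close> ac])
  have "absolutely_continuous_on {0..pi} ?s"
  proof (rule absolutely_continuous_on_lipschitz)
    fix x y :: real assume "x \<le> y"
    show "\<bar>?s y - ?s x\<bar> \<le> real k * (y - x)"
    proof (cases "x = y")
      case False
      with \<open>x \<le> y\<close> have "x < y" by simp
      have d: "(?s has_real_derivative real k * cos (real k * t)) (at t)" for t
        by (auto intro!: derivative_eq_intros)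
      obtain z where "?s y - ?s x = (y - x) * (real k * cos (real k * z))"
        using MVT2[OF \<open>x < y\<close> d] by blast
      then have "\<bar>?s y - ?s x\<bar> = (y - x) * (real k * \<bar>cos (real k * z)\<bar>)"
        using \<open>x < y\<close> by (simp add: abs_mult)
      also have "\<dots> \<le> (y - x) * (real k * 1)"
        using \<open>x < y\<close> by (intro mult_left_mono) auto
      finally show ?thesis by (simp add: mult.commute)
    qed simp
  qed
  then have "((\<lambda>\<theta>. ?G' \<theta> * (L / 2 * sin \<theta>) * ?s \<theta> + cos (real k * \<theta>) * real k * ?G \<theta>) has_integral
      ?G pi * ?s pi - ?G 0 * ?s 0) {0..pi}"
    using N by (intro fundamental_theorem_of_calculus_absolutely_continuous[OF _ absolutely_continuous_on_mult[OF acG]])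
      (auto intro!: derivative_eq_intros)
  then have I1: "((\<lambda>\<theta>. ?G' \<theta> * (L / 2 * sin \<theta>) * ?s \<theta> + cos (real k * \<theta>) * real k * ?G \<theta>) has_integral 0) {0..pi}"
    by simp
  have I2: "((\<lambda>\<theta>. ?G' \<theta> * cos (real m * \<theta>)) has_integral cos_moment ?G' m) {0..pi}" for m
    unfolding cos_moment_def
    by (intro integrable_integral integrable_cheb_point[OF \<open>L > 0\<close> ac der bdd] continuous_intros)
  have I3: "((\<lambda>\<theta>. ?G \<theta> * cos (real k * \<theta>)) has_integral cos_moment ?G k) {0..pi}"
    unfolding cos_moment_def
    by (intro integrable_integral integrable_continuous_interval continuous_intros
        absolutely_continuous_on_imp_continuous_on acG)
  have "((\<lambda>\<theta>. L / 4 * (?G' \<theta> * cos (real (k - 1) * \<theta>) - ?G' \<theta> * cos (real (k + 1) * \<theta>))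
        + real k * (?G \<theta> * cos (real k * \<theta>))) has_integral
      L / 4 * (cos_moment ?G' (k - 1) - cos_moment ?G' (k + 1)) + real k * cos_moment ?G k) {0..pi}"
    by (intro has_integral_add has_integral_mult_right has_integral_diff I2 I3)
  moreover have "L / 4 * (?G' \<theta> * cos (real (k - 1) * \<theta>) - ?G' \<theta> * cos (real (k + 1) * \<theta>))
      + real k * (?G \<theta> * cos (real k * \<theta>))
    = ?G' \<theta> * (L / 2 * sin \<theta>) * ?s \<theta> + cos (real k * \<theta>) * real k * ?G \<theta>" for \<theta>
  proof -
    have "cos (real (k - 1) * \<theta>) - cos (real (k + 1) * \<theta>) = 2 * (sin \<theta> * ?s \<theta>)"
      using \<open>k \<ge> 1\<close> by (simp add: of_nat_diff left_diff_distrib distrib_right cos_diff cos_add)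
    then show ?thesis by (simp add: right_diff_distrib[symmetric])
  qed
  ultimately have I4: "((\<lambda>\<theta>. ?G' \<theta> * (L / 2 * sin \<theta>) * ?s \<theta> + cos (real k * \<theta>) * real k * ?G \<theta>) has_integral
      L / 4 * (cos_moment ?G' (k - 1) - cos_moment ?G' (k + 1)) + real k * cos_moment ?G k) {0..pi}"
    by (rule has_integral_eq[rotated])
  from has_integral_unique[OF I4 I1] show ?thesis
    using \<open>k \<ge> 1\<close> by (simp add: field_simps)
qed

text \<open>The list \<open>a 0, b 0, a 1, b 1, ...\<close> is sorted, and the increments within the
  pairs are its even-indexed terms; the increments across the gaps are nonnegative and are
  dropped.\<close>

lemma total_variation_on_pairs:
  fixes a b :: "nat \<Rightarrow> real"
  assumes tv: "total_variation_on S \<phi> \<le> ennreal V" and "V \<ge> 0"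
    and ab: "\<And>i. i < m \<Longrightarrow> a i \<le> b i \<and> a i \<in> S \<and> b i \<in> S"
    and ba: "\<And>i. Suc i < m \<Longrightarrow> b i \<le> a (Suc i)"
  shows "(\<Sum>i<m. \<bar>\<phi> (b i) - \<phi> (a i)\<bar>) \<le> V"
proof -
  define t where "t = map (\<lambda>j. if even j then a (j div 2) else b (j div 2)) [0..<2 * m]"
  have len: "length t = 2 * m" by (simp add: t_def)
  have nth: "t ! (2 * i) = a i" "t ! Suc (2 * i) = b i" if "i < m" for i
    using that by (simp_all add: t_def)
  have t_le: "t ! j \<le> t ! Suc j" if j: "Suc j < 2 * m" for j
  proof (cases "even j")
    case True
    then obtain i where "j = 2 * i" by blast
    then show ?thesis using nth[of i] ab[of i] j by simp
  next
    case False
    then obtain i where i: "j = Suc (2 * i)" using oddE by fastforce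
    then have "t ! j = b i" "t ! Suc j = a (Suc i)"
      using nth[of i] nth[of "Suc i"] j by simp_all
    then show ?thesis using ba[of i] j i by simp
  qed
  have "sorted t" unfolding sorted_iff_nth_Suc using t_le len by simp
  moreover have "set t \<subseteq> S"
    using ab by (auto simp: t_def)
  ultimately have "(\<Sum>j<length t - 1. ennreal \<bar>\<phi> (t ! Suc j) - \<phi> (t ! j)\<bar>) \<le> total_variation_on S \<phi>"
    unfolding total_variation_on_def by (intro SUP_upper) auto
  also note tv
  finally have *: "(\<Sum>j<length t - 1. ennreal \<bar>\<phi> (t ! Suc j) - \<phi> (t ! j)\<bar>) \<le> ennreal V" .
  have "ennreal (\<Sum>i<m. \<bar>\<phi> (b i) - \<phi> (a i)\<bar>) = (\<Sum>i<m. ennreal \<bar>\<phi> (t ! Suc (2 * i)) - \<phi> (t ! (2 * i))\<bar>)"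
    using nth by (subst sum_ennreal[symmetric]) auto
  also have "\<dots> = (\<Sum>j\<in>(*) 2 ` {..<m}. ennreal \<bar>\<phi> (t ! Suc j) - \<phi> (t ! j)\<bar>)"
    by (subst sum.reindex) (auto simp: inj_on_def)
  also have "\<dots> \<le> (\<Sum>j<length t - 1. ennreal \<bar>\<phi> (t ! Suc j) - \<phi> (t ! j)\<bar>)"
    by (intro sum_mono2) (auto simp: len)
  also note *
  finally show ?thesis using \<open>V \<ge> 0\<close> by (simp add: ennreal_le_iff)
qed

text \<open>With \<open>c = pi / (2 * k)\<close>, the points \<open>2 * i * c + u\<close> and \<open>(2 * i + 2) * c - u\<close> carry opposite
  values of the cosine, so the moment is an average over \<open>u \<in> {0..c}\<close> of sums of differences
  of \<open>g\<close> at interlacing points.\<close>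
lemma cos_moment_bounded_variation:
  assumes "k \<ge> 1" and int: "(\<lambda>\<theta>. g \<theta> * cos (real k * \<theta>)) integrable_on {0..pi}"
    and var: "\<And>m a b. \<lbrakk>\<And>i. i < m \<Longrightarrow> 0 \<le> a i \<and> a i \<le> b i \<and> b i \<le> pi; \<And>i. Suc i < m \<Longrightarrow> b i \<le> a (Suc i)\<rbrakk>
        \<Longrightarrow> (\<Sum>i<m::nat. \<bar>g (b i) - g (a i)\<bar>) \<le> V"
  shows "\<bar>cos_moment g k\<bar> \<le> V / real k"
proof -
  define c where "c = pi / (2 * real k)"
  have kc: "real k * c = pi / 2" and "c > 0" using \<open>k \<ge> 1\<close> by (auto simp: c_def)
  define h where "h \<theta> = g \<theta> * cos (real k * \<theta>)" for \<theta>
  \<comment> \<open>These are the points \<open>i * pi / k\<close>, which cut \<open>{0..pi}\<close>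
    into \<open>k\<close> half-periods; the cosine vanishes at each midpoint
    \<open>l i + c\<close>.\<close>
  define l where "l i = 2 * real i * c" for i
  have l0: "l 0 = 0" and lS: "l (Suc i) = l i + 2 * c" and l_nn: "0 \<le> l i" for i
    using \<open>c > 0\<close> by (auto simp: l_def algebra_simps)
  have l_mono: "l i \<le> l j" if "i \<le> j" for i j
    using that \<open>c > 0\<close> by (simp add: l_def)
  have lk: "l k = pi" using kc by (simp add: l_def algebra_simps)
  have h_int: "h integrable_on {l i..l j}" if "j \<le> k" for i j
    using int l_mono[OF that] lk l_nn[of i] unfolding h_def
    by (intro integrable_on_subinterval[OF int]) auto
  have h_int': "h integrable_on {x..y}" if "0 \<le> x" "y \<le> pi" for x y
    using int that unfolding h_def by (intro integrable_on_subinterval[OF int]) auto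
  have sum_I: "(\<Sum>i<m. integral {l i..l (Suc i)} h) = integral {0..l m} h" if "m \<le> k" for m
    using that
  proof (induction m)
    case (Suc m)
    then have "integral {l 0..l m} h + integral {l m..l (Suc m)} h = integral {l 0..l (Suc m)} h"
      by (intro Henstock_Kurzweil_Integration.integral_combine h_int l_mono) auto
    then show ?case using Suc by (simp add: l0)
  qed (simp add: l0)
  \<comment> \<open>The integrand folded about the midpoint, where the cosine is odd;
    \<open>(-1) ^ i\<close> is the sign of the cosine on the left half.\<close>
  define D where "D i u = (-1) ^ i * (g (l i + u) - g (l (Suc i) - u)) * cos (real k * u)" for i u
  have D: "(D i has_integral integral {l i..l (Suc i)} h) {0..c}" if "i < k" for i
  proof -
    have r: "0 \<le> l i" "l (Suc i) \<le> pi" "l i + c \<le> l (Suc i)" "l i \<le> l i + c"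
      using that l_nn l_mono[of "Suc i" k] lk lS \<open>c > 0\<close> by auto
    have "(h has_integral integral {l i..l i + c} h) (cbox (l i) (l i + c))"
      using r by (simp add: h_int' integrable_integral)
    from has_integral_affinity[OF this, of 1 "l i"]
    have 1: "((\<lambda>u. h (l i + u)) has_integral integral {l i..l i + c} h) {0..c}"
      using \<open>c > 0\<close> by (simp add: add.commute image_add_atLeastAtMost' image_diff_atLeastAtMost)
    have "(h has_integral integral {l i + c..l (Suc i)} h) (cbox (l i + c) (l (Suc i)))"
      using r by (simp add: h_int' integrable_integral)
    from has_integral_affinity[OF this, of "-1" "l (Suc i)"]
    have 2: "((\<lambda>u. h (l (Suc i) - u)) has_integral integral {l i + c..l (Suc i)} h) {0..c}"
      using \<open>c > 0\<close> by (simp add: lS)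
    have "integral {l i..l i + c} h + integral {l i + c..l (Suc i)} h = integral {l i..l (Suc i)} h"
      using r by (intro Henstock_Kurzweil_Integration.integral_combine h_int') auto
    with has_integral_add[OF 1 2]
    have 3: "((\<lambda>u. h (l i + u) + h (l (Suc i) - u)) has_integral integral {l i..l (Suc i)} h) {0..c}"
      by simp
    have "h (l i + u) + h (l (Suc i) - u) = D i u" for u
    proof -
      have "real k * (l i + u) = real k * u + real i * pi"
        using kc by (simp add: l_def algebra_simps)
      moreover have "real k * (l (Suc i) - u) = - (real k * u) + real (Suc i) * pi"
        using kc by (simp add: l_def algebra_simps)
      ultimately have "cos (real k * (l i + u)) = (-1) ^ i * cos (real k * u)"
        "cos (real k * (l (Suc i) - u)) = - ((-1) ^ i * cos (real k * u))"
        by (simp_all only: cos_add cos_npi sin_npi) simp_all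
      then show ?thesis by (simp add: h_def D_def algebra_simps)
    qed
    with 3 show ?thesis by simp
  qed
  have "((\<lambda>u. \<Sum>i<k. D i u) has_integral (\<Sum>i<k. integral {l i..l (Suc i)} h)) {0..c}"
    by (intro has_integral_sum D) auto
  then have S: "((\<lambda>u. \<Sum>i<k. D i u) has_integral cos_moment g k) {0..c}"
    using sum_I[of k] lk by (simp add: cos_moment_def h_def[abs_def])
  \<comment> \<open>The quarter period integrates to \<open>sin (pi / 2) / k\<close>, the origin of
    the factor \<open>1 / k\<close>.\<close>
  have "((\<lambda>u. V * cos (real k * u)) has_integral V * sin (real k * c) / real k - V * sin (real k * 0) / real k) {0..c}"
    using \<open>c > 0\<close> \<open>k \<ge> 1\<close>
    by (intro fundamental_theorem_of_calculus)
       (auto intro!: derivative_eq_intros simp: has_real_derivative_iff_has_vector_derivative[symmetric])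
  then have C: "((\<lambda>u. V * cos (real k * u)) has_integral V / real k) {0..c}"
    by (simp add: kc)
  have "norm (\<Sum>i<k. D i u) \<le> V * cos (real k * u)" if u: "u \<in> {0..c}" for u
  proof -
    have "real k * u \<le> real k * c" using u by (intro mult_left_mono) auto
    then have cos_nn: "cos (real k * u) \<ge> 0" using u kc by (intro cos_ge_zero) (auto intro: order_trans[of _ 0])
    have "norm (\<Sum>i<k. D i u) \<le> (\<Sum>i<k. \<bar>g (l (Suc i) - u) - g (l i + u)\<bar> * cos (real k * u))"
      using cos_nn by (intro sum_norm_le) (auto simp: D_def abs_mult power_abs abs_minus_commute)
    also have "\<dots> = (\<Sum>i<k. \<bar>g (l (Suc i) - u) - g (l i + u)\<bar>) * cos (real k * u)"
      by (simp add: sum_distrib_right)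
    also have "\<dots> \<le> V * cos (real k * u)"
    \<comment> \<open>For each fixed \<open>u\<close> the pairs are ordered and do not overlap, so a
      single variation bound serves all \<open>u\<close>.\<close>
    proof (intro mult_right_mono var cos_nn)
      show "0 \<le> l i + u \<and> l i + u \<le> l (Suc i) - u \<and> l (Suc i) - u \<le> pi" if "i < k" for i
        using that u l_nn[of i] l_mono[of "Suc i" k] lk lS[of i] by auto
      show "l (Suc i) - u \<le> l (Suc i) + u" for i using u by auto
    qed
    finally show ?thesis .
  qed
  then have "norm (integral {0..c} (\<lambda>u. \<Sum>i<k. D i u)) \<le> integral {0..c} (\<lambda>u. V * cos (real k * u))"
    using S C by (intro integral_norm_bound_integral) (auto intro: has_integral_integrable)
  then show ?thesis unfolding integral_unique[OF S] integral_unique[OF C] by simp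
qed

subsection \<open>Cosine series\<close>

text \<open>Integer frequencies, because products of cosines produce \<open>k - m\<close> with
  either sign.\<close>

lemma has_integral_cos_int_mult:
  "((\<lambda>\<theta>. cos (of_int j * \<theta>)) has_integral (if j = 0 then pi else 0)) {0..pi}"
proof (cases "j = 0")
  case True
  then show ?thesis using has_integral_const_real[of "1::real" 0 pi] by simp
next
  case False
  have "((\<lambda>\<theta>. cos (of_int j * \<theta>)) has_integral sin (of_int j * pi) / of_int j - sin (of_int j * 0) / of_int j) {0..pi}"
    using False by (intro fundamental_theorem_of_calculus)
      (auto intro!: derivative_eq_intros simp: has_real_derivative_iff_has_vector_derivative[symmetric])
  then show ?thesis using False by (simp add: sin_npi_int mult.commute)
qed

lemma has_integral_cos_mult_cos:
  "((\<lambda>\<theta>. cos (real k * \<theta>) * cos (real m * \<theta>)) has_integral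
     (if k = m then if k = 0 then pi else pi / 2 else 0)) {0..pi}"
proof -
  have "((\<lambda>\<theta>. (cos (of_int (int k - int m) * \<theta>) + cos (of_int (int k + int m) * \<theta>)) / 2) has_integral
     ((if int k - int m = 0 then pi else 0) + (if int k + int m = 0 then pi else 0)) / 2) {0..pi}"
    by (intro has_integral_divide has_integral_add has_integral_cos_int_mult)
  also have "(\<lambda>\<theta>. (cos (of_int (int k - int m) * \<theta>) + cos (of_int (int k + int m) * \<theta>)) / 2)
      = (\<lambda>\<theta>. cos (real k * \<theta>) * cos (real m * \<theta>))"
    by (auto simp: cos_times_cos left_diff_distrib distrib_right)
  finally show ?thesis by (rule back_subst[of "\<lambda>I. (_ has_integral I) _"]) auto
qed

text \<open>Multiplication by \<open>cos \<theta>\<close> averages neighbouring frequencies, so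
  \<open>h\<close> is orthogonal to every polynomial in \<open>cos \<theta>\<close>. Uniform
  approximation of \<open>h (arccos x)\<close> by polynomials then forces the integral of the square
  of \<open>h\<close> to be 0.\<close>

lemma cos_moments_zero_imp_zero:
  assumes h: "continuous_on {0..pi} h" and zero: "\<And>m. cos_moment h m = 0" and "\<theta> \<in> {0..pi}"
  shows "h \<theta> = 0"
proof -
  have int: "(\<lambda>\<theta>. h \<theta> * c \<theta>) integrable_on {0..pi}" if "continuous_on UNIV c" for c
    by (intro integrable_continuous_interval continuous_intros h continuous_on_subset[OF that]) auto
  have pow: "integral {0..pi} (\<lambda>\<theta>. h \<theta> * (cos \<theta> ^ j * cos (real m * \<theta>))) = 0" for j m
  proof (induction j arbitrary: m)
    case 0
    then show ?case using zero[of m] by (simp add: cos_moment_def)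
  next
    case (Suc j)
    have I: "((\<lambda>\<theta>. h \<theta> * (cos \<theta> ^ j * cos (real m * \<theta>))) has_integral 0) {0..pi}" for m
    proof -
      have "continuous_on UNIV (\<lambda>\<theta>::real. cos \<theta> ^ j * cos (real m * \<theta>))" by (intro continuous_intros)
      from integrable_integral[OF int[OF this]] Suc[of m] show ?thesis by simp
    qed
    \<comment> \<open>For \<open>m = 0\<close> the frequency is -1, replaced by 1 since the cosine
      is even.\<close>
    have "\<exists>m'. \<forall>\<theta>. cos ((real m - 1) * \<theta>) = cos (real m' * \<theta>)"
    proof (cases m)
      case 0
      then show ?thesis by (intro exI[of _ 1]) simp
    next
      case (Suc m')
      then show ?thesis by (intro exI[of _ m']) simp
    qed
    then obtain m' where m': "\<And>\<theta>. cos ((real m - 1) * \<theta>) = cos (real m' * \<theta>)" by blast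
    have eq: "h \<theta> * (cos \<theta> ^ Suc j * cos (real m * \<theta>)) =
      (h \<theta> * (cos \<theta> ^ j * cos (real m' * \<theta>)) + h \<theta> * (cos \<theta> ^ j * cos (real (Suc m) * \<theta>))) / 2" for \<theta>
    proof -
      have "cos (real m' * \<theta>) + cos (real (Suc m) * \<theta>) = 2 * (cos \<theta> * cos (real m * \<theta>))"
        unfolding m'[symmetric] by (simp add: left_diff_distrib distrib_right cos_diff cos_add)
      then show ?thesis
        by (simp add: distrib_left[symmetric] mult_ac)
    qed
    have "((\<lambda>\<theta>. (h \<theta> * (cos \<theta> ^ j * cos (real m' * \<theta>)) +
        h \<theta> * (cos \<theta> ^ j * cos (real (Suc m) * \<theta>))) / 2) has_integral (0 + 0) / 2) {0..pi}"
      by (intro has_integral_divide has_integral_add I)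
    then have "((\<lambda>\<theta>. h \<theta> * (cos \<theta> ^ Suc j * cos (real m * \<theta>))) has_integral (0 + 0) / 2) {0..pi}"
      by (simp only: eq)
    from integral_unique[OF this] show ?case by simp
  qed
  have poly0: "integral {0..pi} (\<lambda>\<theta>. h \<theta> * p (cos \<theta>)) = 0" if rp: "real_polynomial_function p" for p :: "real \<Rightarrow> real"
  proof -
    obtain a n where p: "p = (\<lambda>x. \<Sum>i\<le>n. a i * x ^ i)"
      using rp unfolding real_polynomial_function_iff_sum by (elim exE)
    have I: "((\<lambda>\<theta>. h \<theta> * (cos \<theta> ^ i)) has_integral 0) {0..pi}" for i
    proof -
      have "continuous_on UNIV (\<lambda>\<theta>::real. cos \<theta> ^ i)" by (intro continuous_intros)
      from integrable_integral[OF int[OF this]] pow[of i 0] show ?thesis by simp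
    qed
    have "((\<lambda>\<theta>. \<Sum>i\<le>n. a i * (h \<theta> * (cos \<theta> ^ i))) has_integral (\<Sum>i\<le>n. a i * 0)) {0..pi}"
      by (intro has_integral_sum has_integral_mult_right I) auto
    then show ?thesis
      by (simp add: p sum_distrib_left mult.left_commute integral_unique)
  qed
  have "integral {0..pi} (\<lambda>\<theta>. h \<theta> ^ 2) \<le> 0"
  proof (rule field_le_epsilon)
    fix e :: real assume "e > 0"
    define C where "C = integral {0..pi} (\<lambda>\<theta>. \<bar>h \<theta>\<bar>)"
    have "C \<ge> 0" unfolding C_def by (intro integral_nonneg integrable_continuous_interval continuous_intros h) auto
    \<comment> \<open>\<open>C\<close> may be 0, hence the added 1.\<close>
    define d where "d = e / (C + 1)"
    have "d > 0" using \<open>e > 0\<close> \<open>C \<ge> 0\<close> by (simp add: d_def)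
    have "continuous_on {-1..1} (\<lambda>x. h (arccos x))"
      by (intro continuous_on_compose2[OF h] continuous_on_arccos') (auto simp: arccos_lbound arccos_ubound)
    then obtain p where p: "real_polynomial_function p"
      and close: "\<And>x. x \<in> {-1..1} \<Longrightarrow> \<bar>h (arccos x) - p x\<bar> < d"
      using Stone_Weierstrass_real_polynomial_function[of "{-1..1}" "\<lambda>x. h (arccos x)" d] \<open>d > 0\<close> by auto
    have contp: "continuous_on UNIV (\<lambda>\<theta>. p (cos \<theta>))"
    proof (rule continuous_on_compose2[of UNIV p UNIV cos])
      show "continuous_on UNIV p"
        using p continuous_real_polymonial_function continuous_at_imp_continuous_on by blast
    qed (auto intro: continuous_intros)
    have int_hp: "(\<lambda>\<theta>. h \<theta> * p (cos \<theta>)) integrable_on {0..pi}" by (rule int[OF contp])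
    have int_h2: "(\<lambda>\<theta>. h \<theta> ^ 2) integrable_on {0..pi}"
      by (intro integrable_continuous_interval continuous_intros h)
    \<comment> \<open>Subtracting an integral that is 0 leaves the integrand
      \<open>h \<theta> * (h \<theta> - p (cos \<theta>))\<close>, at most
      \<open>d * \<bar>h \<theta>\<bar>\<close>.\<close>
    have "integral {0..pi} (\<lambda>\<theta>. h \<theta> ^ 2) = integral {0..pi} (\<lambda>\<theta>. h \<theta> ^ 2) - integral {0..pi} (\<lambda>\<theta>. h \<theta> * p (cos \<theta>))"
      by (simp add: poly0[OF p])
    also have "\<dots> = integral {0..pi} (\<lambda>\<theta>. h \<theta> ^ 2 - h \<theta> * p (cos \<theta>))"
      by (rule integral_diff[OF int_h2 int_hp, symmetric])
    also have "\<dots> \<le> integral {0..pi} (\<lambda>\<theta>. d * \<bar>h \<theta>\<bar>)"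
    proof (rule integral_le)
      show "(\<lambda>\<theta>. h \<theta> ^ 2 - h \<theta> * p (cos \<theta>)) integrable_on {0..pi}"
        by (rule integrable_diff[OF int_h2 int_hp])
      show "(\<lambda>\<theta>. d * \<bar>h \<theta>\<bar>) integrable_on {0..pi}"
        by (intro integrable_continuous_interval continuous_intros h)
      fix \<theta> assume "\<theta> \<in> {0..pi}"
      then have "\<bar>h \<theta> - p (cos \<theta>)\<bar> < d" using close[of "cos \<theta>"] by (simp add: arccos_cos)
      then have "\<bar>h \<theta>\<bar> * \<bar>h \<theta> - p (cos \<theta>)\<bar> \<le> \<bar>h \<theta>\<bar> * d" by (intro mult_left_mono) auto
      then show "h \<theta> ^ 2 - h \<theta> * p (cos \<theta>) \<le> d * \<bar>h \<theta>\<bar>"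
        by (metis abs_ge_self abs_mult mult.commute order_trans power2_eq_square right_diff_distrib)
    qed
    also have "\<dots> = d * C" by (simp add: C_def)
    also have "\<dots> \<le> 0 + e" using \<open>C \<ge> 0\<close> \<open>e > 0\<close> by (simp add: d_def field_simps)
    finally show "integral {0..pi} (\<lambda>\<theta>. h \<theta> ^ 2) \<le> 0 + e" .
  qed
  moreover have "integral {0..pi} (\<lambda>\<theta>. h \<theta> ^ 2) \<ge> 0"
    by (intro integral_nonneg integrable_continuous_interval continuous_intros h) auto
  ultimately have "integral {0..pi} (\<lambda>\<theta>. h \<theta> ^ 2) = 0" by simp
  then have "\<forall>\<theta>\<in>{0..pi}. h \<theta> ^ 2 = 0"
    by (subst (asm) integral_eq_0_iff) (auto intro!: continuous_intros h)
  then show ?thesis using \<open>\<theta> \<in> {0..pi}\<close> by simp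
qed

definition cos_coeff :: "(real \<Rightarrow> real) \<Rightarrow> nat \<Rightarrow> real" where
  "cos_coeff g k = (if k = 0 then 1 else 2) / pi * cos_moment g k"

text \<open>Summability makes the series converge uniformly to a continuous \<open>S\<close>.
  Termwise integration and orthogonality show that \<open>S\<close> and \<open>G\<close> have the
  same moments, so their difference vanishes.\<close>

lemma cosine_series_sums:
  assumes G: "continuous_on {0..pi} G" and "summable (\<lambda>k. \<bar>cos_moment G k\<bar>)" and "\<theta> \<in> {0..pi}"
  shows "(\<lambda>k. cos_coeff G k * cos (real k * \<theta>)) sums G \<theta>"
proof -
  define a where "a = cos_coeff G"
  have "summable (\<lambda>k. 2 / pi * \<bar>cos_moment G k\<bar>)" using assms(2) by (rule summable_mult)
  then have a_sum: "summable (\<lambda>k. \<bar>a k\<bar>)"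
    by (rule summable_comparison_test')
      (auto simp: a_def cos_coeff_def abs_mult intro!: mult_right_mono divide_right_mono)
  have s: "summable (\<lambda>k. a k * cos (real k * t))" for t
    by (rule summable_comparison_test'[OF a_sum]) (auto simp: abs_mult intro: mult_left_le)
  define S where "S t = (\<Sum>k. a k * cos (real k * t))" for t
  \<comment> \<open>The extra cosine lets one statement serve twice: \<open>m = 0\<close> yields
    continuity of \<open>S\<close>, general \<open>m\<close> its moments.\<close>
  have unif: "uniform_limit {0..pi} (\<lambda>n t. \<Sum>k<n. a k * cos (real k * t) * cos (real m * t))
      (\<lambda>t. S t * cos (real m * t)) sequentially" for m
  proof -
    have "norm (a k * cos (real k * t) * cos (real m * t)) \<le> \<bar>a k\<bar>" for k t
      by (auto simp: abs_mult mult.assoc intro!: mult_left_le mult_le_one)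
    then have "uniform_limit {0..pi} (\<lambda>n t. \<Sum>k<n. a k * cos (real k * t) * cos (real m * t))
        (\<lambda>t. \<Sum>k. a k * cos (real k * t) * cos (real m * t)) sequentially"
      by (intro Weierstrass_m_test[OF _ a_sum]) auto
    then show ?thesis
      using suminf_mult2[OF s] by (simp add: S_def)
  qed
  have contS: "continuous_on {0..pi} S"
    using uniform_limit_theorem[OF _ unif[of 0]] by (simp add: continuous_intros)
  have momS: "cos_moment S m = cos_moment G m" for m
  proof -
    obtain I J where IJ: "\<And>n. ((\<lambda>t. \<Sum>k<n. a k * cos (real k * t) * cos (real m * t)) has_integral I n) {0..pi}"
       "((\<lambda>t. S t * cos (real m * t)) has_integral J) {0..pi}" "I \<longlonglongrightarrow> J"
      by (rule uniform_limit_integral[OF unif[of m]]) (auto intro!: continuous_intros)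
    \<comment> \<open>By orthogonality only the term \<open>k = m\<close> contributes, so the
      moments of the partial sums are eventually constant.\<close>
    have "I n = cos_moment G m" if "n > m" for n
    proof -
      have "((\<lambda>t. \<Sum>k<n. a k * (cos (real k * t) * cos (real m * t))) has_integral
          (\<Sum>k<n. a k * (if k = m then if k = 0 then pi else pi / 2 else 0))) {0..pi}"
        by (intro has_integral_sum has_integral_mult_right has_integral_cos_mult_cos) auto
      then have "I n = (\<Sum>k<n. a k * (if k = m then if k = 0 then pi else pi / 2 else 0))"
        using IJ(1)[of n] by (simp add: mult.assoc has_integral_unique)
      also have "\<dots> = (\<Sum>k<n. if k = m then a m * (if m = 0 then pi else pi / 2) else 0)"
        by (intro sum.cong) auto
      also have "\<dots> = cos_moment G m" using that by (simp add: a_def cos_coeff_def)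
      finally show ?thesis .
    qed
    then have "I \<longlonglongrightarrow> cos_moment G m"
      by (intro tendsto_eventually eventually_sequentiallyI[of "Suc m"]) auto
    then have "J = cos_moment G m" using IJ(3) LIMSEQ_unique by blast
    then show ?thesis using IJ(2) by (simp add: cos_moment_def integral_unique)
  qed
  have "G \<theta> - S \<theta> = 0"
  proof (rule cos_moments_zero_imp_zero[OF _ _ \<open>\<theta> \<in> {0..pi}\<close>])
    show "continuous_on {0..pi} (\<lambda>t. G t - S t)" by (intro continuous_intros G contS)
    have int: "(\<lambda>t. g t * cos (real m * t)) integrable_on {0..pi}" if "continuous_on {0..pi} g" for g m
      by (intro integrable_continuous_interval continuous_intros that)
    show "cos_moment (\<lambda>t. G t - S t) m = 0" for m
      using integral_diff[OF int[OF G, of m] int[OF contS, of m]] momS[of m]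
      by (simp add: cos_moment_def left_diff_distrib)
  qed
  then show ?thesis using s[of \<theta>] by (simp add: S_def a_def sums_iff)
qed

text \<open>These are the Chebyshev polynomials of the first kind, built by the recurrence
  \<open>T (k + 2) = 2 * x * T (k + 1) - T k\<close>.\<close>

lemma cos_multiple_poly: "\<exists>p::real poly. degree p \<le> k \<and> (\<forall>\<theta>. poly p (cos \<theta>) = cos (real k * \<theta>))"
proof (induction k rule: induct_nat_012)
  case 0
  then show ?case by (intro exI[of _ 1]) simp
next
  case 1
  then show ?case by (intro exI[of _ "[:0, 1:]"]) simp
next
  case (ge2 m)
  obtain p where p: "degree p \<le> m" "\<And>\<theta>. poly p (cos \<theta>) = cos (real m * \<theta>)"
    using ge2(1) by auto
  obtain r where r: "degree r \<le> Suc m" "\<And>\<theta>. poly r (cos \<theta>) = cos (real (Suc m) * \<theta>)"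
    using ge2(2) by blast
  have "degree ([:0, 2:] * r - p) \<le> Suc (Suc m)"
    using p(1) r(1) degree_mult_le[of "[:0, 2:]" r] by (intro degree_diff_le) auto
  moreover have "poly ([:0, 2:] * r - p) (cos \<theta>) = cos (real (Suc (Suc m)) * \<theta>)" for \<theta>
  proof -
    have "cos (real (Suc m) * \<theta> + \<theta>) + cos (real (Suc m) * \<theta> - \<theta>) = 2 * cos \<theta> * cos (real (Suc m) * \<theta>)"
      by (simp add: cos_add cos_diff)
    moreover have "real (Suc m) * \<theta> + \<theta> = real (Suc (Suc m)) * \<theta>" "real (Suc m) * \<theta> - \<theta> = real m * \<theta>"
      by (simp_all add: algebra_simps)
    ultimately show ?thesis by (simp only: p r poly_diff poly_mult poly_pCons poly_0) simp
  qed
  ultimately show ?case by blast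
qed

subsection \<open>Separable kernels\<close>

definition separable :: "nat \<Rightarrow> ('a::real_normed_vector \<Rightarrow> 'a \<Rightarrow> real) \<Rightarrow> bool" where
  "separable R K \<longleftrightarrow> (\<exists>g h :: nat \<Rightarrow> 'a \<Rightarrow> real.
     (\<forall>i<R. real_polynomial_function (g i) \<and> real_polynomial_function (h i)) \<and>
     (\<forall>x y. K x y = (\<Sum>i<R. g i x * h i y)))"

lemma separable_const: "separable 1 (\<lambda>x y. c)"
  unfolding separable_def
  by (intro exI[of _ "\<lambda>i x. c"] exI[of _ "\<lambda>i x. 1"]) (auto intro: real_polynomial_function.intros)

lemma separable_add:
  assumes "separable R K" "separable R' K'"
  shows "separable (R + R') (\<lambda>x y. K x y + K' x y)"
proof -
  obtain g h g' h' where
    *: "\<forall>i<R. real_polynomial_function (g i) \<and> real_polynomial_function (h i)"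
       "\<forall>x y. K x y = (\<Sum>i<R. g i x * h i y)"
       "\<forall>i<R'. real_polynomial_function (g' i) \<and> real_polynomial_function (h' i)"
       "\<forall>x y. K' x y = (\<Sum>i<R'. g' i x * h' i y)"
    using assms unfolding separable_def by blast
  have "(\<Sum>i<R + n. (if i < R then g i else g' (i - R)) x * (if i < R then h i else h' (i - R)) y)
      = (\<Sum>i<R. g i x * h i y) + (\<Sum>i<n. g' i x * h' i y)" for x y n
    by (induction n) auto
  then show ?thesis unfolding separable_def using *
    by (intro exI[of _ "\<lambda>i. if i < R then g i else g' (i - R)"] exI[of _ "\<lambda>i. if i < R then h i else h' (i - R)"])
      auto
qed

lemma separable_mult:
  assumes "separable R K" "real_polynomial_function u" "real_polynomial_function v"
  shows "separable R (\<lambda>x y. u x * v y * K x y)"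
proof -
  obtain g h where
    *: "\<forall>i<R. real_polynomial_function (g i) \<and> real_polynomial_function (h i)"
       "\<forall>x y. K x y = (\<Sum>i<R. g i x * h i y)"
    using assms unfolding separable_def by blast
  then show ?thesis unfolding separable_def using assms
    by (intro exI[of _ "\<lambda>i x. u x * g i x"] exI[of _ "\<lambda>i y. v y * h i y"])
      (auto intro: real_polynomial_function.intros simp: sum_distrib_left mult_ac)
qed

text \<open>\<open>poly_combs n zs\<close> consists of the polynomials of degree at most \<open>n\<close> in the functions \<open>zs\<close>;
  the recursion splits off the monomials that contain the first of them, as in Pascal's rule.\<close>
fun poly_combs :: "nat \<Rightarrow> ('b \<Rightarrow> real) list \<Rightarrow> ('b \<Rightarrow> real) set" where
  "poly_combs n [] = range (\<lambda>c z. c)"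
| "poly_combs 0 (a # zs) = range (\<lambda>c z. c)"
| "poly_combs (Suc n) (a # zs) =
     {\<lambda>z. p z + a z * r z | p r. p \<in> poly_combs (Suc n) zs \<and> r \<in> poly_combs n (a # zs)}"

lemma poly_combs_ConsI:
  "\<lbrakk>p \<in> poly_combs (Suc n) zs; r \<in> poly_combs n (a # zs)\<rbrakk>
    \<Longrightarrow> (\<lambda>z. p z + a z * r z) \<in> poly_combs (Suc n) (a # zs)"
  unfolding poly_combs.simps(3) by (rule CollectI, rule exI[of _ p], rule exI[of _ r]) simp

lemma poly_combs_const: "(\<lambda>z. c) \<in> poly_combs n zs"
proof (induction n zs arbitrary: c rule: poly_combs.induct)
  case (3 n a zs)
  have "(\<lambda>z. c + a z * 0) \<in> poly_combs (Suc n) (a # zs)"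
    using poly_combs_ConsI[OF 3(1)[of c] 3(2)[of 0]] .
  then show ?case by simp
qed auto

lemma poly_combs_add:
  "\<lbrakk>p \<in> poly_combs n zs; r \<in> poly_combs n zs\<rbrakk> \<Longrightarrow> (\<lambda>z. p z + r z) \<in> poly_combs n zs"
proof (induction n zs arbitrary: p r rule: poly_combs.induct)
  case (3 n a zs)
  obtain p1 p2 where p: "p = (\<lambda>z. p1 z + a z * p2 z)" "p1 \<in> poly_combs (Suc n) zs" "p2 \<in> poly_combs n (a # zs)"
    using 3(3) by auto
  obtain r1 r2 where r: "r = (\<lambda>z. r1 z + a z * r2 z)" "r1 \<in> poly_combs (Suc n) zs" "r2 \<in> poly_combs n (a # zs)"
    using 3(4) by auto
  have "(\<lambda>z. (p1 z + r1 z) + a z * (p2 z + r2 z)) \<in> poly_combs (Suc n) (a # zs)"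
    by (rule poly_combs_ConsI[OF 3(1)[OF p(2) r(2)] 3(2)[OF p(3) r(3)]])
  then show ?case by (simp add: p r algebra_simps)
qed auto

text \<open>Starts the induction for \<open>poly_combs_mult\<close>: at degree 0 the other factor is
  a constant.\<close>

lemma poly_combs_mult_const:
  "b \<in> set zs \<Longrightarrow> (\<lambda>z. b z * c) \<in> poly_combs (Suc 0) zs"
proof (induction zs)
  case (Cons a zs)
  show ?case
  proof (cases "b = a")
    case True
    have "(\<lambda>z. 0 + a z * c) \<in> poly_combs (Suc 0) (a # zs)"
      by (rule poly_combs_ConsI[OF poly_combs_const poly_combs_const])
    then show ?thesis by (simp add: True del: poly_combs.simps)
  next
    case False
    then have "(\<lambda>z. b z * c + a z * 0) \<in> poly_combs (Suc 0) (a # zs)"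
      using Cons by (intro poly_combs_ConsI poly_combs_const) auto
    then show ?thesis by (simp del: poly_combs.simps)
  qed
qed simp

text \<open>Multiplication by the head is the recursive clause itself, with 0 as the part free of
  it; any other entry is multiplied into both parts.\<close>

lemma poly_combs_mult:
  "\<lbrakk>b \<in> set zs; p \<in> poly_combs n zs\<rbrakk> \<Longrightarrow> (\<lambda>z. b z * p z) \<in> poly_combs (Suc n) zs"
proof (induction n zs arbitrary: p rule: poly_combs.induct)
  case (2 a zs)
  then show ?case using poly_combs_mult_const[OF 2(1)] by auto
next
  case (3 n a zs)
  show ?case
  proof (cases "b = a")
    case True
    have "(\<lambda>z. 0 + a z * p z) \<in> poly_combs (Suc (Suc n)) (a # zs)"
      by (rule poly_combs_ConsI[OF poly_combs_const 3(4)])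
    then show ?thesis by (simp add: True del: poly_combs.simps)
  next
    case False
    then have b: "b \<in> set zs" using 3 by auto
    obtain p1 p2 where p: "p = (\<lambda>z. p1 z + a z * p2 z)" "p1 \<in> poly_combs (Suc n) zs" "p2 \<in> poly_combs n (a # zs)"
      using 3(4) by auto
    have "(\<lambda>z. b z * p1 z + a z * (b z * p2 z)) \<in> poly_combs (Suc (Suc n)) (a # zs)"
      by (rule poly_combs_ConsI[OF 3(1)[OF b p(2)] 3(2)[OF 3(3) p(3)]])
    then show ?thesis by (simp add: p algebra_simps del: poly_combs.simps)
  qed
qed auto

text \<open>Horner's scheme: peeling off the constant coefficient leaves one multiplication by the
  sum, carried out summand by summand.\<close>

lemma poly_combs_poly:
  assumes "degree p \<le> n"
  shows "(\<lambda>z. poly p (\<Sum>b\<leftarrow>zs. b z)) \<in> poly_combs n zs"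
proof -
  have mult: "(\<lambda>z. (\<Sum>b\<leftarrow>ys. b z) * r z) \<in> poly_combs (Suc n) zs"
    if "set ys \<subseteq> set zs" "r \<in> poly_combs n zs" for ys r n
    using that(1)
  proof (induction ys)
    case Nil
    then show ?case using poly_combs_const[of 0 "Suc n" zs] by simp
  next
    case (Cons b ys)
    have "(\<lambda>z. b z * r z + (\<Sum>b\<leftarrow>ys. b z) * r z) \<in> poly_combs (Suc n) zs"
      using Cons by (intro poly_combs_add[OF poly_combs_mult[OF _ that(2)]]) auto
    then show ?case by (simp add: distrib_right)
  qed
  show ?thesis using assms
  proof (induction n arbitrary: p)
    case 0
    then obtain c where "p = [:c:]" by (metis degree_eq_zeroE le_zero_eq)
    then show ?case using poly_combs_const[of c 0 zs] by simp
  next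
    case (Suc n)
    obtain c r where p: "p = pCons c r" by (metis pCons_cases)
    have "degree r \<le> n" using Suc(2) by (auto simp: p degree_pCons_eq_if split: if_splits)
    from Suc(1)[OF this]
    have "(\<lambda>z. c + (\<Sum>b\<leftarrow>zs. b z) * poly r (\<Sum>b\<leftarrow>zs. b z)) \<in> poly_combs (Suc n) zs"
      by (intro poly_combs_add poly_combs_const mult) auto
    then show ?case by (simp add: p)
  qed
qed

text \<open>The counts obey Pascal's rule exactly as the recursion splits: the part without the head
  has one variable fewer, the cofactor of the head one degree less, and multiplying by
  \<open>u x * v y\<close> preserves the number of terms.\<close>

lemma separable_poly_combs:
  assumes "p \<in> poly_combs n zs"
    and "\<And>b. b \<in> set zs \<Longrightarrow> \<exists>u v. real_polynomial_function u \<and> real_polynomial_function v \<and> b = (\<lambda>(x, y). u x * v y)"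
  shows "separable ((n + length zs) choose length zs) (\<lambda>x y. p (x, y))"
  using assms
proof (induction n zs arbitrary: p rule: poly_combs.induct)
  case (3 n a zs)
  obtain p1 p2 where p: "p = (\<lambda>z. p1 z + a z * p2 z)" "p1 \<in> poly_combs (Suc n) zs" "p2 \<in> poly_combs n (a # zs)"
    using 3(3) by auto
  obtain u v where uv: "real_polynomial_function u" "real_polynomial_function v" "a = (\<lambda>(x, y). u x * v y)"
    using 3(4)[of a] by auto
  have "separable ((Suc n + length zs) choose length zs) (\<lambda>x y. p1 (x, y))"
    "separable ((n + length (a # zs)) choose length (a # zs)) (\<lambda>x y. p2 (x, y))"
    using 3(4) by (intro 3(1)[OF p(2)] 3(2)[OF p(3)]; simp)+
  from separable_add[OF this(1) separable_mult[OF this(2) uv(1,2)]]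
  show ?case by (simp add: p uv add.commute)
qed (use separable_const in auto)

lemma separable_poly_norm_diff:
  fixes p :: "real poly"
  assumes "degree p \<le> n"
  shows "separable ((n + CARD('d) + 2) choose (CARD('d) + 2))
    (\<lambda>x y :: real ^ 'd::finite. poly p ((norm (x - y))\<^sup>2))"
proof -
  obtain js :: "'d list" where "set js = UNIV" and "distinct js"
    using finite_distinct_list[OF finite_class.finite_UNIV] by blast
  then have len: "length js = CARD('d)" by (metis distinct_card)
  \<comment> \<open>The factors 1 bring the two squared norms into the product form
    \<open>u x * v y\<close>.\<close>
  define zs where "zs = (\<lambda>(x :: real ^ 'd, y :: real ^ 'd). (norm x)\<^sup>2 * 1) # (\<lambda>(x, y). 1 * (norm y)\<^sup>2) #
      map (\<lambda>i (x, y). x $ i * (- 2 * y $ i)) js"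
  have coord: "real_polynomial_function (\<lambda>x :: real ^ 'd. x $ i)" for i
    by (intro real_polynomial_function.intros bounded_linear_vec_nth)
  have norm: "real_polynomial_function (\<lambda>x :: real ^ 'd. (norm x)\<^sup>2)"
    unfolding power2_norm_eq_inner inner_vec_def
    by (auto intro!: real_polynomial_function_sum real_polynomial_function.intros(4) coord)
  have const: "real_polynomial_function (\<lambda>x :: real ^ 'd. c)" for c by (rule real_polynomial_function.intros)
  have "\<exists>u v. real_polynomial_function u \<and> real_polynomial_function v \<and> b = (\<lambda>(x, y). u x * v y)"
    if b: "b \<in> set zs" for b
  proof -
    consider "b = (\<lambda>(x, y). (norm x)\<^sup>2 * 1)" | "b = (\<lambda>(x, y). 1 * (norm y)\<^sup>2)"
      | i where "b = (\<lambda>(x, y). x $ i * (- 2 * y $ i))"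
      using b unfolding zs_def list.set set_map by blast
    then show ?thesis
    proof cases
      case 1 then show ?thesis using norm const by blast
    next
      case 2 then show ?thesis using norm const by blast
    next
      case (3 i)
      have "real_polynomial_function (\<lambda>y :: real ^ 'd. - 2 * y $ i)"
        by (intro real_polynomial_function.intros coord)
      then show ?thesis using 3 coord by blast
    qed
  qed
  from separable_poly_combs[OF poly_combs_poly[OF assms] this]
  have "separable ((n + length zs) choose length zs) (\<lambda>x y. poly p (\<Sum>b\<leftarrow>zs. b (x, y)))" .
  moreover have "(\<Sum>b\<leftarrow>zs. b (x, y)) = (norm (x - y))\<^sup>2" for x y
  proof -
    have "(\<Sum>i\<leftarrow>js. x $ i * (- 2 * y $ i)) = (\<Sum>i\<in>UNIV. x $ i * (- 2 * y $ i))"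
      using \<open>set js = UNIV\<close> \<open>distinct js\<close> by (metis sum_list_distinct_conv_sum_set)
    also have "\<dots> = - 2 * (x \<bullet> y)"
      by (simp add: inner_vec_def sum_distrib_left mult_ac flip: sum_negf)
    finally show ?thesis
      by (simp add: zs_def o_def case_prod_unfold power2_norm_eq_inner inner_diff inner_commute)
  qed
  ultimately show ?thesis by (simp add: zs_def len add.commute add.left_commute)
qed

subsection \<open>Chebyshev approximation\<close>

text \<open>The induction descends from order \<open>q\<close>, where the variation bound applies,
  to order 0. The condition \<open>k > i\<close> keeps every factor of the denominator positive
  throughout the recursion.\<close>

lemma cos_moment_decay:
  assumes "L > 0" "V \<ge> 0"
    and deriv: "derivatives_upto q {0..L} f F"
    and ac: "\<And>k. k < q \<Longrightarrow> absolutely_continuous_on {0..L} (F k)"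
    and bv: "total_variation_on {0..L} (F q) \<le> ennreal V"
    and "q \<ge> 1" "i \<le> q" "k > i"
  shows "\<bar>cos_moment (\<lambda>\<theta>. F (q - i) (cheb_point L \<theta>)) k\<bar> \<le> V * (L / 2) ^ i / (\<Prod>l\<le>i. real k - real l)"
  using \<open>i \<le> q\<close> \<open>k > i\<close>
proof (induction i arbitrary: k)
  \<comment> \<open>The pointwise derivatives of lower order are weakened to almost everywhere, so
    that all orders are treated alike.\<close>
  have der: "AE x\<in>{0..L} in lborel. (F j has_real_derivative F (Suc j) x) (at x within {0..L})" if "j < q" for j
    using deriv that unfolding derivatives_upto_def by (cases "Suc j = q") auto
  have bdd: "\<exists>B. \<forall>x\<in>{0..L}. \<bar>F j x\<bar> \<le> B" if "j \<le> q" for j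
  proof (cases "j = q")
    case True
    \<comment> \<open>\<open>F q\<close> need not be continuous; its bound comes from the variation
      between 0 and \<open>x\<close>.\<close>
    have "\<bar>F q x - F q 0\<bar> \<le> V" if "x \<in> {0..L}" for x
      using total_variation_on_pairs[OF bv \<open>V \<ge> 0\<close>, of 1 "\<lambda>_. 0" "\<lambda>_. x"] that \<open>L > 0\<close> by simp
    then show ?thesis using True by (intro exI[of _ "\<bar>F q 0\<bar> + V"]) (smt (verit))
  next
    case False
    then have "bounded (F j ` {0..L})"
      using that by (intro compact_imp_bounded compact_continuous_image
          absolutely_continuous_on_imp_continuous_on ac) auto
    then show ?thesis by (auto simp: bounded_iff)
  qed
  {
    case (0 k)
    obtain B where B: "\<And>x. x \<in> {0..L} \<Longrightarrow> \<bar>F q x\<bar> \<le> B" using bdd[OF order_refl] by blast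
    have "q - 1 < q" using \<open>q \<ge> 1\<close> by simp
    have "AE x\<in>{0..L} in lborel. (F (q - 1) has_real_derivative F q x) (at x within {0..L})"
      using der[OF \<open>q - 1 < q\<close>] \<open>q \<ge> 1\<close> by simp
    note int = integrable_cheb_point[OF \<open>L > 0\<close> ac[OF \<open>q - 1 < q\<close>] this B]
    have "\<bar>cos_moment (\<lambda>\<theta>. F q (cheb_point L \<theta>)) k\<bar> \<le> V / real k"
    proof (rule cos_moment_bounded_variation)
      show "(\<lambda>\<theta>. F q (cheb_point L \<theta>) * cos (real k * \<theta>)) integrable_on {0..pi}"
        by (intro int continuous_intros)
      fix m and a b :: "nat \<Rightarrow> real"
      assume "\<And>i. i < m \<Longrightarrow> 0 \<le> a i \<and> a i \<le> b i \<and> b i \<le> pi" "\<And>i. Suc i < m \<Longrightarrow> b i \<le> a (Suc i)"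
      then show "(\<Sum>i<m. \<bar>F q (cheb_point L (b i)) - F q (cheb_point L (a i))\<bar>) \<le> V"
        using cheb_point_in[OF \<open>L > 0\<close>]
        by (intro total_variation_on_pairs[OF bv \<open>V \<ge> 0\<close>] conjI cheb_point_mono[OF \<open>L > 0\<close>])
          (auto, (meson Suc_lessD order_trans)+)
    qed (use 0 in auto)
    then show ?case by simp
  next
    case (Suc i k)
    define j where "j = q - Suc i"
    have j: "j < q" "q - i = Suc j" using Suc(2) by (auto simp: j_def)
    obtain B where B: "\<And>x. x \<in> {0..L} \<Longrightarrow> \<bar>F (Suc j) x\<bar> \<le> B" using bdd[of "Suc j"] j by fastforce
    define M where "M m = cos_moment (\<lambda>\<theta>. F (q - i) (cheb_point L \<theta>)) m" for m
    define C where "C = V * (L / 2) ^ i"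
    define P where "P m = (\<Prod>l\<le>i. real m - real l)" for m
    have "C \<ge> 0" using \<open>L > 0\<close> \<open>V \<ge> 0\<close> by (simp add: C_def)
    have M: "\<bar>M m\<bar> \<le> C / P m" if "m > i" for m
      using Suc that by (simp add: M_def C_def P_def)
    have P: "0 < P (k - 1)" "P (k - 1) \<le> P (k + 1)"
      using Suc(3) by (auto simp: P_def intro!: prod_pos prod_mono)
    have "cos_moment (\<lambda>\<theta>. F j (cheb_point L \<theta>)) k = L / (4 * real k) * (M (k + 1) - M (k - 1))"
      unfolding M_def j(2) using Suc(3) by (intro cos_moment_by_parts[OF \<open>L > 0\<close> ac[OF j(1)] der[OF j(1)] B]) auto
    then have "\<bar>cos_moment (\<lambda>\<theta>. F j (cheb_point L \<theta>)) k\<bar> = L / (4 * real k) * \<bar>M (k + 1) - M (k - 1)\<bar>"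
      using \<open>L > 0\<close> by (simp add: abs_mult)
    \<comment> \<open>\<open>P\<close> grows, so both moments obey the weaker bound at
      \<open>k - 1\<close>; the two of them turn \<open>L / 4\<close> into
      \<open>L / 2\<close>.\<close>
    also have "\<dots> \<le> L / (4 * real k) * (C / P (k - 1) + C / P (k - 1))"
    proof (intro mult_left_mono)
      have "C / P (k + 1) \<le> C / P (k - 1)"
        using P \<open>C \<ge> 0\<close> by (intro divide_left_mono) auto
      then show "\<bar>M (k + 1) - M (k - 1)\<bar> \<le> C / P (k - 1) + C / P (k - 1)"
        using M[of "k + 1"] M[of "k - 1"] Suc(3) by linarith
    qed (use \<open>L > 0\<close> in auto)
    also have "\<dots> = C * (L / 2) / (real k * P (k - 1))"
      by (simp add: field_simps)
    also have "real k * P (k - 1) = (\<Prod>l\<le>Suc i. real k - real l)"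
      using Suc(3) by (subst prod.atMost_Suc_shift) (simp add: P_def of_nat_diff algebra_simps)
    finally show ?case by (simp add: C_def j_def mult_ac)
  }
qed

text \<open>The sum telescopes, since the summand is the difference of the reciprocals of
  \<open>\<Prod>l<q. k - 1 - l\<close> and \<open>\<Prod>l<q. k - l\<close>, divided by \<open>q\<close>.\<close>
lemma sum_inverse_falling_factorial_le:
  assumes "q \<ge> 1" "n \<ge> q"
  shows "(\<Sum>k<N. 1 / (\<Prod>l\<le>q. real (Suc n + k) - real l)) \<le> 1 / (real q * (\<Prod>l<q. real n - real l))"
proof -
  define P where "P k = (\<Prod>l<q. real k - real l)" for k
  have Ppos: "P k > 0" if "k \<ge> q" for k
    using that by (auto simp: P_def intro!: prod_pos)
  obtain r where r: "q = Suc r" using \<open>q \<ge> 1\<close> by (metis Suc_le_D One_nat_def)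
  have step: "1 / (\<Prod>l\<le>q. real (Suc k) - real l) = (1 / P k - 1 / P (Suc k)) / real q" if "k \<ge> q" for k
  proof -
    \<comment> \<open>Removing the factor \<open>l = 0\<close> leaves \<open>P k\<close>, removing
      \<open>l = q\<close> leaves \<open>P (Suc k)\<close>; the two removed factors differ by
      \<open>q\<close>.\<close>
    define A where "A = (\<Prod>l\<le>q. real (Suc k) - real l)"
    have 1: "A = real (Suc k) * P k"
      unfolding A_def P_def r by (subst prod.atMost_Suc_shift) (simp add: lessThan_Suc_atMost)
    have 2: "A = P (Suc k) * (real (Suc k) - real q)"
      unfolding A_def P_def by (simp flip: lessThan_Suc_atMost)
    have "A > 0" using 1 Ppos[OF that] by simp
    have "1 / P k = real (Suc k) / A" using 1 Ppos[OF that] by (simp del: of_nat_Suc)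
    moreover have "1 / P (Suc k) = (real (Suc k) - real q) / A"
      using 2 Ppos[of "Suc k"] that by simp
    ultimately have "1 / P k - 1 / P (Suc k) = real q / A"
      by (simp add: diff_divide_distrib[symmetric])
    then show ?thesis using \<open>q \<ge> 1\<close> by (simp add: A_def)
  qed
  have "(\<Sum>k<N. 1 / (\<Prod>l\<le>q. real (Suc n + k) - real l)) = (\<Sum>k<N. (1 / P (n + k) - 1 / P (n + Suc k)) / real q)"
    using step[of "n + _"] \<open>n \<ge> q\<close> by (intro sum.cong) auto
  also have "\<dots> = (1 / P n - 1 / P (n + N)) / real q"
    using sum_lessThan_telescope'[of "\<lambda>k. 1 / P (n + k)" N] by (simp add: sum_divide_distrib[symmetric])
  also have "\<dots> \<le> 1 / P n / real q"
    using Ppos[of "n + N"] \<open>n \<ge> q\<close> by (intro divide_right_mono) auto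
  finally show ?thesis by (simp add: P_def mult.commute)
qed

text \<open>Cosines are at most 1 in absolute value, so truncating after index \<open>n\<close>
  costs at most the sum of the absolute values of the later coefficients, uniformly in
  \<open>\<theta>\<close>.\<close>

lemma chebyshev_approximation:
  assumes "L > 0" "V \<ge> 0"
    and deriv: "derivatives_upto q {0..L} f F"
    and ac: "\<And>k. k < q \<Longrightarrow> absolutely_continuous_on {0..L} (F k)"
    and bv: "total_variation_on {0..L} (F q) \<le> ennreal V"
    and "q \<ge> 1" "n > q"
  obtains p :: "real poly" where "degree p \<le> n"
    "\<And>x. x \<in> {0..L} \<Longrightarrow> \<bar>f x - poly p x\<bar> \<le> 2 * V * L ^ q / (pi * real q * (2 * (real n - real q)) ^ q)"
proof -
  define G where "G \<theta> = F 0 (cheb_point L \<theta>)" for \<theta>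
  define a where "a = cos_coeff G"
  define C where "C = V * (L / 2) ^ q"
  define E where "E = 2 / pi * (C * (1 / (real q * (\<Prod>l<q. real n - real l))))"
  have "C \<ge> 0" using \<open>L > 0\<close> \<open>V \<ge> 0\<close> by (simp add: C_def)
  have contG: "continuous_on {0..pi} G"
    unfolding G_def using \<open>q \<ge> 1\<close>
    by (intro absolutely_continuous_on_imp_continuous_on absolutely_continuous_on_cheb_point \<open>L > 0\<close> ac) auto
  have decay: "\<bar>cos_moment G (Suc n + k)\<bar> \<le> C * (1 / (\<Prod>l\<le>q. real (Suc n + k) - real l))" for k
    using cos_moment_decay[OF assms(1-6) order_refl, of "Suc n + k"] \<open>n > q\<close>
    by (simp add: G_def[abs_def] C_def)
  have partial: "(\<Sum>k<N. \<bar>cos_moment G (Suc n + k)\<bar>) \<le> C * (1 / (real q * (\<Prod>l<q. real n - real l)))" for N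
  proof -
    have "(\<Sum>k<N. \<bar>cos_moment G (Suc n + k)\<bar>) \<le> (\<Sum>k<N. C * (1 / (\<Prod>l\<le>q. real (Suc n + k) - real l)))"
      by (intro sum_mono decay)
    also have "\<dots> = C * (\<Sum>k<N. 1 / (\<Prod>l\<le>q. real (Suc n + k) - real l))"
      by (rule sum_distrib_left[symmetric])
    also have "\<dots> \<le> C * (1 / (real q * (\<Prod>l<q. real n - real l)))"
      using \<open>C \<ge> 0\<close> \<open>q \<ge> 1\<close> \<open>n > q\<close> by (intro mult_left_mono sum_inverse_falling_factorial_le) auto
    finally show ?thesis .
  qed
  have "summable (\<lambda>k. \<bar>cos_moment G (Suc n + k)\<bar>)"
    by (rule summableI_nonneg_bounded[OF _ partial]) auto
  then have summ: "summable (\<lambda>k. \<bar>cos_moment G k\<bar>)"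
    using summable_iff_shift[of "\<lambda>k. \<bar>cos_moment G k\<bar>" "Suc n"] by (simp add: add.commute)
  have tail: "\<bar>G \<theta> - (\<Sum>k<Suc n. a k * cos (real k * \<theta>))\<bar> \<le> E" if "\<theta> \<in> {0..pi}" for \<theta>
  proof -
    have "(\<lambda>k. a k * cos (real k * \<theta>)) sums G \<theta>"
      unfolding a_def by (rule cosine_series_sums[OF contG summ that])
    then have lim: "(\<lambda>N. \<Sum>k<N. a (k + Suc n) * cos (real (k + Suc n) * \<theta>))
        \<longlonglongrightarrow> G \<theta> - (\<Sum>k<Suc n. a k * cos (real k * \<theta>))"
      using sums_split_initial_segment unfolding sums_def by blast
    show ?thesis
    proof (rule tendsto_upperbound[OF tendsto_rabs[OF lim]])
      have "\<bar>\<Sum>k<N. a (k + Suc n) * cos (real (k + Suc n) * \<theta>)\<bar> \<le> E" for N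
      proof -
        have "\<bar>\<Sum>k<N. a (k + Suc n) * cos (real (k + Suc n) * \<theta>)\<bar> \<le> (\<Sum>k<N. \<bar>a (k + Suc n)\<bar>)"
          by (rule order_trans[OF sum_abs]) (auto intro!: sum_mono simp: abs_mult mult_left_le)
        also have "\<dots> = 2 / pi * (\<Sum>k<N. \<bar>cos_moment G (Suc n + k)\<bar>)"
          unfolding sum_distrib_left by (intro sum.cong) (auto simp: a_def cos_coeff_def abs_mult add.commute)
        also have "\<dots> \<le> E" unfolding E_def by (intro mult_left_mono partial) auto
        finally show ?thesis .
      qed
      then show "\<forall>\<^sub>F N in sequentially. \<bar>\<Sum>k<N. a (k + Suc n) * cos (real (k + Suc n) * \<theta>)\<bar> \<le> E" by simp
    qed simp
  qed
  obtain T :: "nat \<Rightarrow> real poly" where T: "\<And>k. degree (T k) \<le> k" "\<And>k \<theta>. poly (T k) (cos \<theta>) = cos (real k * \<theta>)"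
    using cos_multiple_poly by metis
  \<comment> \<open>The inner polynomial recovers \<open>cos \<theta>\<close> from
    \<open>x = cheb_point L \<theta>\<close>.\<close>
  define p where "p = (\<Sum>k<Suc n. smult (a k) (T k)) \<circ>\<^sub>p [:1, - 2 / L:]"
  have "degree (\<Sum>k<Suc n. smult (a k) (T k)) \<le> n"
  proof (rule degree_sum_le)
    show "degree (smult (a k) (T k)) \<le> n" if "k \<in> {..<Suc n}" for k
      using that T(1)[of k] degree_smult_le[of "a k" "T k"] by simp
  qed simp
  moreover have "degree [:1, - 2 / L:] \<le> 1" by simp
  ultimately have "degree p \<le> n * 1"
    unfolding p_def by (intro order_trans[OF degree_pcompose_le] mult_le_mono)
  moreover have "\<bar>f x - poly p x\<bar> \<le> 2 * V * L ^ q / (pi * real q * (2 * (real n - real q)) ^ q)" if "x \<in> {0..L}" for x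
  proof -
    define \<theta> where "\<theta> = arccos (1 - 2 * x / L)"
    have r: "-1 \<le> 1 - 2 * x / L" "1 - 2 * x / L \<le> 1" using that \<open>L > 0\<close> by (auto simp: field_simps)
    have \<theta>: "\<theta> \<in> {0..pi}" "cos \<theta> = 1 - 2 * x / L"
      using r by (auto simp: \<theta>_def arccos_lbound arccos_ubound)
    have "G \<theta> = f x"
      using that \<theta> \<open>L > 0\<close> deriv by (simp add: G_def cheb_point_def derivatives_upto_def)
    moreover have "poly [:1, - 2 / L:] x = cos \<theta>" using \<theta>(2) by (simp add: mult.commute)
    then have "poly p x = (\<Sum>k<Suc n. a k * cos (real k * \<theta>))"
      by (simp only: p_def poly_pcompose poly_sum poly_smult T(2))
    ultimately have "\<bar>f x - poly p x\<bar> \<le> E" using tail[OF \<theta>(1)] by simp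
    also have "E \<le> 2 / pi * (C * (1 / (real q * (real n - real q) ^ q)))"
    proof -
      \<comment> \<open>Each factor is replaced by the lower bound \<open>n - q\<close>, turning the
        falling factorial into the power of the claim; the \<open>2 ^ q\<close> there comes from
        \<open>(L / 2) ^ q\<close>.\<close>
      have "(\<Prod>l<q. real n - real q) \<le> (\<Prod>l<q. real n - real l)"
        using \<open>n > q\<close> by (intro prod_mono) auto
      then have "real q * (real n - real q) ^ q \<le> real q * (\<Prod>l<q. real n - real l)"
        by (intro mult_left_mono) auto
      moreover have "0 < real q * (real n - real q) ^ q" using \<open>n > q\<close> \<open>q \<ge> 1\<close> by simp
      ultimately have "1 / (real q * (\<Prod>l<q. real n - real l)) \<le> 1 / (real q * (real n - real q) ^ q)"
        by (intro frac_le[OF zero_le_one order_refl])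
      then show ?thesis unfolding E_def using \<open>C \<ge> 0\<close> by (intro mult_left_mono) auto
    qed
    also have "\<dots> = 2 * V * L ^ q / (pi * real q * (2 * (real n - real q)) ^ q)"
      unfolding C_def power_divide power_mult_distrib by (simp add: mult_ac)
    finally show ?thesis .
  qed
  ultimately show ?thesis by (intro that) auto
qed

section \<open>From one variable to the kernel on the cube\<close>

theorem theorem2p4:
  fixes q :: nat and D Vq :: real
    and f :: "real \<Rightarrow> real" and F :: "nat \<Rightarrow> real \<Rightarrow> real"
  defines "cube \<equiv> cbox (0 :: real ^ 'd::finite) (\<chi> i. D / sqrt (real CARD('d)))"
  assumes q: "q \<ge> 1" and D: "D > 0" and Vq: "Vq \<ge> 0"
    and deriv: "derivatives_upto q {0..D\<^sup>2} f F"
    and ac: "\<forall>k<q. absolutely_continuous_on {0..D\<^sup>2} (F k)"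
    and bv: "total_variation_on {0..D\<^sup>2} (F q) \<le> ennreal Vq"
  shows "\<forall>n>q. let R = (n + CARD('d) + 2) choose (CARD('d) + 2) in
     \<exists>g h :: nat \<Rightarrow> real ^ 'd \<Rightarrow> real.
       (\<forall>i\<in>{1..R}. real_polynomial_function (g i) \<and> real_polynomial_function (h i)) \<and>
       (\<forall>x\<in>cube. \<forall>y\<in>cube.
          \<bar>f ((norm (x - y))\<^sup>2) - (\<Sum>i=1..R. g i x * h i y)\<bar>
            \<le> 2 * Vq * D ^ (2 * q) / (pi * real q * (2 * (real n - real q)) ^ q))"
proof (intro allI impI)
  fix n assume "n > q"
  define R where "R = (n + CARD('d) + 2) choose (CARD('d) + 2)"
  have "D\<^sup>2 > 0" using D by simp
  obtain p :: "real poly" where p: "degree p \<le> n" and err: "\<And>x. x \<in> {0..D\<^sup>2} \<Longrightarrow>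
      \<bar>f x - poly p x\<bar> \<le> 2 * Vq * (D\<^sup>2) ^ q / (pi * real q * (2 * (real n - real q)) ^ q)"
    by (rule chebyshev_approximation[OF \<open>D\<^sup>2 > 0\<close> Vq deriv _ bv q \<open>n > q\<close>]) (use ac in auto)
  obtain g h :: "nat \<Rightarrow> real ^ 'd \<Rightarrow> real" where
    gh: "\<And>i. i < R \<Longrightarrow> real_polynomial_function (g i) \<and> real_polynomial_function (h i)"
    and sum: "\<And>x y. poly p ((norm (x - y))\<^sup>2) = (\<Sum>i<R. g i x * h i y)"
    using separable_poly_norm_diff[OF p] unfolding separable_def R_def by blast
  \<comment> \<open>The side \<open>D / sqrt d\<close> gives the cube diameter \<open>D\<close>, so
    squared distances stay where \<open>f\<close> is controlled.\<close>
  have dist: "(norm (x - y))\<^sup>2 \<in> {0..D\<^sup>2}" if "x \<in> cube" "y \<in> cube" for x y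
  proof -
    have "\<bar>x $ i - y $ i\<bar> \<le> D / sqrt (real CARD('d))" for i
      using that unfolding cube_def mem_box_cart by (simp add: abs_le_iff) (smt (verit))
    then have "(x $ i - y $ i)\<^sup>2 \<le> (D / sqrt (real CARD('d)))\<^sup>2" for i
      using power_mono[of "\<bar>x $ i - y $ i\<bar>" "D / sqrt (real CARD('d))" 2] by simp
    then have "(\<Sum>i\<in>UNIV. (x $ i - y $ i)\<^sup>2) \<le> (\<Sum>i\<in>(UNIV :: 'd set). (D / sqrt (real CARD('d)))\<^sup>2)"
      by (intro sum_mono)
    also have "\<dots> = D\<^sup>2" by (simp add: power_divide)
    also have "(\<Sum>i\<in>UNIV. (x $ i - y $ i)\<^sup>2) = (norm (x - y))\<^sup>2"
      by (simp add: power2_norm_eq_inner inner_vec_def flip: power2_eq_square)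
    finally show ?thesis by simp
  qed
  have "\<bar>f ((norm (x - y))\<^sup>2) - (\<Sum>i=1..R. g (i - 1) x * h (i - 1) y)\<bar>
            \<le> 2 * Vq * D ^ (2 * q) / (pi * real q * (2 * (real n - real q)) ^ q)"
    if "x \<in> cube" "y \<in> cube" for x y
  proof -
    have "(\<Sum>i=1..R. g (i - 1) x * h (i - 1) y) = poly p ((norm (x - y))\<^sup>2)"
      by (simp add: sum sum.atLeast1_atMost_eq)
    then show ?thesis using err[OF dist[OF that]] by (simp add: power_mult)
  qed
  then show "let R = (n + CARD('d) + 2) choose (CARD('d) + 2) in
     \<exists>g h :: nat \<Rightarrow> real ^ 'd \<Rightarrow> real.
       (\<forall>i\<in>{1..R}. real_polynomial_function (g i) \<and> real_polynomial_function (h i)) \<and>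
       (\<forall>x\<in>cube. \<forall>y\<in>cube.
          \<bar>f ((norm (x - y))\<^sup>2) - (\<Sum>i=1..R. g i x * h i y)\<bar>
            \<le> 2 * Vq * D ^ (2 * q) / (pi * real q * (2 * (real n - real q)) ^ q))"
    unfolding Let_def R_def[symmetric] using gh
    by (intro exI[of _ "\<lambda>i. g (i - 1)"] exI[of _ "\<lambda>i. h (i - 1)"]) auto
qed

end
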